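(* Suppose $m^{+}\not\equiv 0$ and $n^{+}\not\equiv 0$ on $]T_1,T_2[$. Then either (i) $C_k^{>++}$ and $C_k^{<++}$ are nonempty for all $k\ge 1$, or (ii) for some integer $k_0\ge 1$: $C_k^{>++}$ and $C_k^{<++}$ are nonempty for all $1\le k\le k_0$; one of $C_{k_0+1}^{>++}$, $C_{k_0+1}^{<++}$ is nonempty, the other one being empty; and $C_k^{>++}$ and $C_k^{<++}$ are empty for all $k\ge k_0+2$.
   Context: Let $T_1<T_2$ be reals and let $p,q,m,n\in C[T_1,T_2]$ be real-valued with $p>0$, $q\ge 0$ on $[T_1,T_2]$, $m\not\equiv 0$, $n\not\equiv 0$. Put $Lu:=-(p(t)u')'+q(t)u$ and, for any function $u$, $u^{\pm}:=\max\{\pm u,0\}$ (likewise $m^{\pm}$, $n^{\pm}$). For $(a,b)\in\mathbb{R}^2$ consider the problem $$(P)\qquad Lu=a\,m(t)u^{+}-b\,n(t)u^{-}\ \text{in } ]T_1,T_2[,\qquad u(T_1)=u(T_2)=0,$$ solutions being functions $u\in C^1[T_1,T_2]$ with $pu'\in C^1[T_1,T_2]$. For $k\ge 1$, $C_k^{>}$ (resp. $C_k^{<}$) is the set of $(a,b)\in\mathbb{R}^2$ such that $(P)$ has a solution $u$ with exactly $k-1$ zeros in $]T_1,T_2[$ and $u'(T_1)>0$ (resp. $u'(T_1)<0$). With $\mathbb{R}^{+}=]0,+\infty[$, put $C_k^{>++}:=C_k^{>}\cap(\mathbb{R}^{+}\times\mathbb{R}^{+})$ and $C_k^{<++}:=C_k^{<}\cap(\mathbb{R}^{+}\times\mathbb{R}^{+})$.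 *)

theory Defs
  imports "HOL-Analysis.Analysis"
begin

text \<open>
  Functions on the compact interval \<open>[T1,T2]\<close> are total functions on the reals of which only
  the values on \<open>{T1..T2}\<close> matter. Derivatives are therefore taken relative to \<open>{T1..T2}\<close>,
  i.e. they are one-sided at the end points and two-sided in the interior.
\<close>

definition deriv_Icc :: "real \<Rightarrow> real \<Rightarrow> (real \<Rightarrow> real) \<Rightarrow> real \<Rightarrow> real" where
  "deriv_Icc T1 T2 f t = vector_derivative f (at t within {T1..T2})"

definition C1_Icc :: "real \<Rightarrow> real \<Rightarrow> (real \<Rightarrow> real) \<Rightarrow> bool" where
  "C1_Icc T1 T2 f \<longleftrightarrow>
     f differentiable_on {T1..T2} \<and> continuous_on {T1..T2} (deriv_Icc T1 T2 f)"

definition pos_part :: "(real \<Rightarrow> real) \<Rightarrow> real \<Rightarrow> real" where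
  "pos_part f t = max (f t) 0"

definition neg_part :: "(real \<Rightarrow> real) \<Rightarrow> real \<Rightarrow> real" where
  "neg_part f t = max (- f t) 0"

definition SL_op ::
  "real \<Rightarrow> real \<Rightarrow> (real \<Rightarrow> real) \<Rightarrow> (real \<Rightarrow> real) \<Rightarrow> (real \<Rightarrow> real) \<Rightarrow> real \<Rightarrow> real" where
  "SL_op T1 T2 p q u t =
     - deriv_Icc T1 T2 (\<lambda>s. p s * deriv_Icc T1 T2 u s) t + q t * u t"

definition solves_P ::
  "real \<Rightarrow> real \<Rightarrow> (real \<Rightarrow> real) \<Rightarrow> (real \<Rightarrow> real) \<Rightarrow> (real \<Rightarrow> real) \<Rightarrow> (real \<Rightarrow> real) \<Rightarrow>
   real \<Rightarrow> real \<Rightarrow> (real \<Rightarrow> real) \<Rightarrow> bool" where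
  "solves_P T1 T2 p q m n a b u \<longleftrightarrow>
     C1_Icc T1 T2 u \<and>
     C1_Icc T1 T2 (\<lambda>t. p t * deriv_Icc T1 T2 u t) \<and>
     (\<forall>t\<in>{T1<..<T2}. SL_op T1 T2 p q u t = a * m t * pos_part u t - b * n t * neg_part u t) \<and>
     u T1 = 0 \<and> u T2 = 0"

definition exactly_zeros :: "real \<Rightarrow> real \<Rightarrow> nat \<Rightarrow> (real \<Rightarrow> real) \<Rightarrow> bool" where
  "exactly_zeros T1 T2 j u \<longleftrightarrow>
     finite {t\<in>{T1<..<T2}. u t = 0} \<and> card {t\<in>{T1<..<T2}. u t = 0} = j"

text \<open>The Fucik sets \<open>C_gt\<close>, \<open>C_lt\<close> are only meaningful for \<open>k \<ge> 1\<close> (truncated \<open>k - 1\<close>).\<close>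

definition C_gt ::
  "real \<Rightarrow> real \<Rightarrow> (real \<Rightarrow> real) \<Rightarrow> (real \<Rightarrow> real) \<Rightarrow> (real \<Rightarrow> real) \<Rightarrow> (real \<Rightarrow> real) \<Rightarrow>
   nat \<Rightarrow> (real \<times> real) set" where
  "C_gt T1 T2 p q m n k =
     {(a, b). \<exists>u. solves_P T1 T2 p q m n a b u \<and> exactly_zeros T1 T2 (k - 1) u \<and>
                  deriv_Icc T1 T2 u T1 > 0}"

definition C_lt ::
  "real \<Rightarrow> real \<Rightarrow> (real \<Rightarrow> real) \<Rightarrow> (real \<Rightarrow> real) \<Rightarrow> (real \<Rightarrow> real) \<Rightarrow> (real \<Rightarrow> real) \<Rightarrow>
   nat \<Rightarrow> (real \<times> real) set" where
  "C_lt T1 T2 p q m n k =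
     {(a, b). \<exists>u. solves_P T1 T2 p q m n a b u \<and> exactly_zeros T1 T2 (k - 1) u \<and>
                  deriv_Icc T1 T2 u T1 < 0}"

definition C_gt_pp ::
  "real \<Rightarrow> real \<Rightarrow> (real \<Rightarrow> real) \<Rightarrow> (real \<Rightarrow> real) \<Rightarrow> (real \<Rightarrow> real) \<Rightarrow> (real \<Rightarrow> real) \<Rightarrow>
   nat \<Rightarrow> (real \<times> real) set" where
  "C_gt_pp T1 T2 p q m n k = C_gt T1 T2 p q m n k \<inter> ({0<..} \<times> {0<..})"

definition C_lt_pp ::
  "real \<Rightarrow> real \<Rightarrow> (real \<Rightarrow> real) \<Rightarrow> (real \<Rightarrow> real) \<Rightarrow> (real \<Rightarrow> real) \<Rightarrow> (real \<Rightarrow> real) \<Rightarrow>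
   nat \<Rightarrow> (real \<times> real) set" where
  "C_lt_pp T1 T2 p q m n k = C_lt T1 T2 p q m n k \<inter> ({0<..} \<times> {0<..})"

end

theory Submission
  imports Defs
begin

text \<open>
  A nontrivial solution of \<open>(P)\<close> is described by its Pruefer angle \<open>\<theta>\<close>, where \<open>u = r sin \<theta>\<close> and
  \<open>p u' = r cos \<theta>\<close>. For the jumping nonlinearity the angle satisfies a scalar Lipschitz equation, with
  weight \<open>a m\<close> while \<open>sin \<theta> > 0\<close> and \<open>b n\<close> while \<open>sin \<theta> < 0\<close>. Multiples of \<open>\<pi>\<close> are crossed upward
  only, so \<open>(a, b)\<close> lies in \<open>C_gt k\<close> exactly if the angle that starts from \<open>0\<close> at \<open>T1\<close> ends at
  \<open>k \<pi>\<close> (\<open>C_gt_of_angle\<close>, \<open>angle_of_C_gt\<close>).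
  
  Then \<open>C_gt_pp k\<close> is nonempty if and only if there are points \<open>t1 < \<dots> < tk\<close> in the open
  interval at which \<open>m\<close>, \<open>n\<close>, \<open>m\<close>, \<dots> are positive alternately (\<open>C_gt_pp_nonempty_iff\<close>). The points are
  necessary since a nodal interval on which the active weight is nonpositive cannot exist when \<open>q \<ge> 0\<close>:
  a positive \<open>u\<close> would have a nondecreasing flux and could not return to zero
  (\<open>quarter_turn_needs_positive_weight\<close>). They are sufficient because one may take \<open>a = b = \<nu>\<close>: the
  final angle is below \<open>\<pi>/2\<close> for \<open>\<nu> = 0\<close>, at least \<open>k \<pi>\<close> for large \<open>\<nu>\<close> as the angle
  makes a fast half-turn near every one of the points (\<open>half_turn\<close>), and continuous in \<open>\<nu>\<close>
  (\<open>prufer_gronwall\<close>). Replacing \<open>u\<close> by \<open>- u\<close> gives the same for \<open>C_lt_pp k\<close> with \<open>m\<close> and \<open>n\<close>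
  exchanged.
  
  The rest is combinatorics of alternating chains. Deleting the first or the last point of a
  chain of length \<open>k + 1\<close> leaves chains of length \<open>k\<close> of both kinds, and of two chains of length \<open>k\<close> of
  different kind one can be prolonged by the first point of the other (\<open>alternates_extend\<close>). Hence the last length at
  which both kinds occur, if there is one, is followed by a length at which exactly one kind occurs,
  and then by none (\<open>paired_chain_pattern\<close>).
\<close>

section \<open>First hitting times, upward crossings and Gronwall estimates\<close>

lemma first_hit:
  fixes g :: "real \<Rightarrow> real"
  assumes "continuous_on {a..b} g" "a \<le> b" "g a < c" "c \<le> g b"
  obtains \<tau> where "a < \<tau>" "\<tau> \<le> b" "g \<tau> = c" "\<And>t. a \<le> t \<Longrightarrow> t < \<tau> \<Longrightarrow> g t < c"
proof -
  let ?S = "{a..b} \<inter> g -` {c}"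
  have "closed ?S"
    using assms(1) by (intro continuous_closed_preimage) auto
  hence "compact ?S"
    by (auto simp: compact_eq_bounded_closed intro: bounded_subset[of "{a..b}"])
  moreover have "?S \<noteq> {}"
    using IVT'[of g a c b] assms by fastforce
  ultimately obtain \<tau> where \<tau>: "\<tau> \<in> ?S" "\<And>s. s \<in> ?S \<Longrightarrow> \<tau> \<le> s"
    using compact_attains_inf[of ?S] by metis
  show ?thesis
  proof
    show "a < \<tau>" using \<tau>(1) assms(3) by (cases "a = \<tau>") auto
    show "\<tau> \<le> b" "g \<tau> = c" using \<tau>(1) by auto
    fix t assume t: "a \<le> t" "t < \<tau>"
    show "g t < c"
    proof (rule ccontr)
      assume "\<not> g t < c"
      moreover have "continuous_on {a..t} g"
        using assms(1) by (rule continuous_on_subset) (use t \<tau> in auto)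
      ultimately obtain s where "a \<le> s" "s \<le> t" "g s = c"
        using IVT'[of g a c t] assms t by force
      with \<tau>(2)[of s] t \<tau>(1) show False by auto
    qed
  qed
qed

text \<open>
  If \<open>g\<close> came back to \<open>0\<close> after having been positive, it would be non-increasing through the first
  return, where its derivative is required to be positive. Applied to a Pruefer angle this says
  that each multiple of \<open>\<pi>\<close> is crossed only once.
\<close>

lemma positive_after_upward_crossing:
  fixes g :: "real \<Rightarrow> real"
  assumes der: "\<And>t. t \<in> {a..b} \<Longrightarrow> (g has_real_derivative g' t) (at t within {a..b})"
    and up: "\<And>t. t \<in> {a..b} \<Longrightarrow> g t = 0 \<Longrightarrow> g' t > 0"
    and "a < b" "g a \<ge> 0"
  shows "g b > 0"
proof (rule ccontr)
  assume neg: "\<not> g b > 0"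
  have cont: "continuous_on {a..b} g"
    by (rule DERIV_continuous_on[OF der])
  have "\<exists>s\<in>{a..<b}. g s > 0"
  proof (cases "g a = 0")
    case True
    with has_real_derivative_pos_inc_right[OF der[of a] up[of a]] \<open>a < b\<close>
    obtain d where d: "d > 0" "\<And>h. h > 0 \<Longrightarrow> a + h \<in> {a..b} \<Longrightarrow> h < d \<Longrightarrow> g a < g (a + h)"
      by auto
    define h where "h = min d (b - a) / 2"
    have h: "0 < h" "h < d" "h < b - a"
      using d(1) \<open>a < b\<close> by (auto simp: h_def min_def)
    with d(2)[of h] True show ?thesis
      by (intro bexI[of _ "a + h"]) auto
  next
    case False
    with assms(3,4) show ?thesis by (intro bexI[of _ a]) auto
  qed
  then obtain s where s: "a \<le> s" "s < b" "g s > 0" by auto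
  have "continuous_on {s..b} (\<lambda>t. - g t)"
    by (intro continuous_intros continuous_on_subset[OF cont]) (use s in auto)
  then obtain \<tau> where \<tau>: "s < \<tau>" "\<tau> \<le> b" "g \<tau> = 0" "\<And>t. s \<le> t \<Longrightarrow> t < \<tau> \<Longrightarrow> g t > 0"
    using first_hit[of s b "\<lambda>t. - g t" 0] s neg by auto
  have "(g has_real_derivative g' \<tau>) (at \<tau> within {a..b})" "0 < g' \<tau>"
    using der[of \<tau>] up[of \<tau>] \<tau> s by auto
  from has_real_derivative_pos_inc_left[OF this]
  obtain d where d: "d > 0" "\<And>h. h > 0 \<Longrightarrow> \<tau> - h \<in> {a..b} \<Longrightarrow> h < d \<Longrightarrow> g (\<tau> - h) < g \<tau>"
    by auto
  define h where "h = min d (\<tau> - s) / 2"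
  have h: "0 < h" "h < d" "h < \<tau> - s"
    using d(1) \<tau>(1) by (auto simp: h_def min_def)
  have "g (\<tau> - h) < g \<tau>" using d(2)[of h] h s \<tau> by auto
  moreover have "g (\<tau> - h) > 0" using \<tau>(4)[of "\<tau> - h"] h by auto
  ultimately show False using \<tau>(3) by simp
qed

lemma gronwall:
  fixes h :: "real \<Rightarrow> real"
  assumes "a \<le> b" "continuous_on {a..b} h"
    and der: "\<And>t. a < t \<Longrightarrow> t < b \<Longrightarrow> (h has_real_derivative h' t) (at t)"
    and le: "\<And>t. a < t \<Longrightarrow> t < b \<Longrightarrow> h' t \<le> K * h t"
  shows "h b \<le> h a * exp (K * (b - a))"
proof -
  have "h b * exp (- K * b) \<le> h a * exp (- K * a)"
  proof (rule DERIV_nonpos_imp_decreasing_open[of a b "\<lambda>t. h t * exp (- K * t)"])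
    fix t assume t: "a < t" "t < b"
    have "((\<lambda>t. h t * exp (- K * t)) has_real_derivative (h' t - K * h t) * exp (- K * t)) (at t)"
      by (auto intro!: derivative_eq_intros der t simp: algebra_simps)
    moreover have "(h' t - K * h t) * exp (- K * t) \<le> 0"
      using le[OF t] by (simp add: mult_nonpos_nonneg)
    ultimately show "\<exists>y. ((\<lambda>t. h t * exp (- K * t)) has_real_derivative y) (at t) \<and> y \<le> 0" by blast
  qed (use assms in \<open>auto intro!: continuous_intros\<close>)
  hence "h b * exp (- K * b) * exp (K * b) \<le> h a * exp (- K * a) * exp (K * b)"
    by (intro mult_right_mono) auto
  thus ?thesis
    by (simp add: mult.assoc flip: exp_add) (simp add: algebra_simps)
qed

lemma continuous_on_Icc_bounded:
  fixes f :: "real \<Rightarrow> real"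
  assumes "continuous_on {a..b} f"
  obtains B where "B > 0" "\<And>t. t \<in> {a..b} \<Longrightarrow> \<bar>f t\<bar> \<le> B"
proof -
  have "bounded (f ` {a..b})"
    by (intro compact_imp_bounded compact_continuous_image assms) auto
  then obtain B where "B > 0" "\<forall>x\<in>f ` {a..b}. norm x \<le> B"
    using bounded_pos by blast
  thus ?thesis using that by auto
qed

section \<open>Existence for a scalar Lipschitz equation\<close>

text \<open>
  Writing the solution as \<open>exp (K * t) * g t\<close> with \<open>K = 2 * L\<close> turns the Picard operator into a
  contraction with constant \<open>1 / 2\<close> for the plain supremum distance of \<open>g\<close>, so that one
  application of Banach's theorem covers the whole interval. Functions are continued
  constantly outside \<open>{a..b}\<close> in order to be bounded and continuous on the whole line.
\<close>

lemma ode_exists: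
  fixes f :: "real \<Rightarrow> real \<Rightarrow> real"
  assumes "a \<le> b" "L > 0"
    and cont: "continuous_on ({a..b} \<times> UNIV) (\<lambda>(t, x). f t x)"
    and lip: "\<And>t x y. t \<in> {a..b} \<Longrightarrow> \<bar>f t x - f t y\<bar> \<le> L * \<bar>x - y\<bar>"
  obtains \<theta> where "\<theta> a = x0"
    "\<And>t. t \<in> {a..b} \<Longrightarrow> (\<theta> has_real_derivative f t (\<theta> t)) (at t within {a..b})"
proof -
  define K where "K = 2 * L"
  have K: "K > 0" using assms by (simp add: K_def)
  define clip where "clip t = max a (min b t)" for t
  have clip: "clip t \<in> {a..b}" "t \<in> {a..b} \<Longrightarrow> clip t = t" for t
    using assms(1) by (auto simp: clip_def)
  define rhs where "rhs g s = f s (exp (K * s) * apply_bcontfun g s)" for g :: "real \<Rightarrow>\<^sub>C real" and s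
  have cont_f: "continuous_on {a..b} (\<lambda>s. f s (h s))" if "continuous_on {a..b} h" for h
  proof -
    have "continuous_on {a..b} (\<lambda>s. (s, h s))" by (intro continuous_intros that)
    from continuous_on_compose2[OF cont this] show ?thesis by auto
  qed
  have cont_rhs: "continuous_on {a..b} (rhs g)" for g
    unfolding rhs_def by (intro cont_f continuous_intros continuous_on_apply_bcontfun)
  define pic where "pic g t = exp (- K * t) * (x0 + integral {a..t} (rhs g))" for g t
  have cont_pic: "continuous_on {a..b} (pic g)" for g
    unfolding pic_def
    by (intro continuous_intros indefinite_integral_continuous_1 integrable_continuous_real cont_rhs)
  have "(\<lambda>t. pic g (clip t)) \<in> bcontfun" for g
  proof -
    obtain B where B: "\<And>t. t \<in> {a..b} \<Longrightarrow> \<bar>pic g t\<bar> \<le> B"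
      using continuous_on_Icc_bounded[OF cont_pic] by metis
    have "continuous_on UNIV clip" unfolding clip_def by (intro continuous_intros)
    hence "continuous_on UNIV (\<lambda>t. pic g (clip t))"
      by (rule continuous_on_compose2[OF cont_pic]) (use clip in auto)
    thus ?thesis
      by (rule bcontfun_normI[where b = B]) (use B clip in auto)
  qed
  hence app: "apply_bcontfun (Bcontfun (\<lambda>t. pic g (clip t))) = (\<lambda>t. pic g (clip t))" for g
    by (simp add: Bcontfun_inverse)
  define \<Phi> where "\<Phi> g = Bcontfun (\<lambda>t. pic g (clip t))" for g
  have "dist (\<Phi> g) (\<Phi> h) \<le> (1 / 2) * dist g h" for g h
  proof (rule dist_bound)
    fix t0
    define t where "t = clip t0"
    have t: "a \<le> t" "t \<le> b" using clip[of t0] by (auto simp: t_def)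
    let ?D = "dist g h"
    \<comment> \<open>the pointwise Lipschitz bound \<open>L * exp (K * s) * ?D\<close> has this explicit primitive because \<open>K = 2 * L\<close>\<close>
    have prim: "((\<lambda>s. L * exp (K * s) * ?D) has_integral
        exp (K * t) * ?D / 2 - exp (K * a) * ?D / 2) {a..t}"
    proof (rule fundamental_theorem_of_calculus[OF t(1)])
      fix s assume "s \<in> {a..t}"
      have "((\<lambda>s. exp (K * s) * ?D / 2) has_real_derivative L * exp (K * s) * ?D) (at s within {a..t})"
        by (auto intro!: derivative_eq_intros simp: K_def)
      thus "((\<lambda>s. exp (K * s) * ?D / 2) has_vector_derivative L * exp (K * s) * ?D) (at s within {a..t})"
        by (simp add: has_real_derivative_iff_has_vector_derivative)
    qed
    have int: "rhs k integrable_on {a..t}" for k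
      by (intro integrable_continuous_real continuous_on_subset[OF cont_rhs]) (use t in auto)
    have "\<bar>integral {a..t} (rhs g) - integral {a..t} (rhs h)\<bar>
        = norm (integral {a..t} (\<lambda>s. rhs g s - rhs h s))"
      by (simp add: integral_diff int)
    also have "\<dots> \<le> integral {a..t} (\<lambda>s. L * exp (K * s) * ?D)"
    proof (rule integral_norm_bound_integral)
      show "(\<lambda>s. rhs g s - rhs h s) integrable_on {a..t}" by (intro integrable_diff int)
      show "(\<lambda>s. L * exp (K * s) * ?D) integrable_on {a..t}" using prim by blast
      fix s assume s: "s \<in> {a..t}"
      have "norm (rhs g s - rhs h s) \<le> L * \<bar>exp (K * s) * g s - exp (K * s) * h s\<bar>"
        unfolding rhs_def real_norm_def by (rule lip) (use s t in auto)
      also have "\<dots> = L * exp (K * s) * dist (g s) (h s)"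
        by (simp add: dist_real_def abs_mult flip: right_diff_distrib)
      also have "\<dots> \<le> L * exp (K * s) * ?D"
        using \<open>L > 0\<close> by (intro mult_left_mono dist_bounded) auto
      finally show "norm (rhs g s - rhs h s) \<le> L * exp (K * s) * ?D" .
    qed
    also have "\<dots> = exp (K * t) * ?D / 2 - exp (K * a) * ?D / 2"
      using prim by (rule integral_unique)
    also have "\<dots> \<le> exp (K * t) * ?D / 2" by simp
    finally have *: "\<bar>integral {a..t} (rhs g) - integral {a..t} (rhs h)\<bar> \<le> exp (K * t) * ?D / 2" .
    have "dist (\<Phi> g t0) (\<Phi> h t0) = \<bar>pic g t - pic h t\<bar>"
      by (simp only: \<Phi>_def app dist_real_def t_def)
    also have "\<dots> = exp (- K * t) * \<bar>integral {a..t} (rhs g) - integral {a..t} (rhs h)\<bar>"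
      by (simp add: pic_def abs_mult flip: right_diff_distrib)
    also have "\<dots> \<le> exp (- K * t) * (exp (K * t) * ?D / 2)"
      by (intro mult_left_mono *) auto
    also have "\<dots> = (1 / 2) * ?D"
      by (simp flip: exp_add mult.assoc)
    finally show "dist (\<Phi> g t0) (\<Phi> h t0) \<le> (1 / 2) * ?D" .
  qed
  then obtain g where g: "\<Phi> g = g"
    using banach_fix_type[of "1 / 2" \<Phi>] by auto
  define \<theta> where "\<theta> t = x0 + integral {a..t} (rhs g)" for t
  have \<theta>: "exp (K * t) * g t = \<theta> t" if "t \<in> {a..b}" for t
  proof -
    have "g t = pic g t"
      by (subst g[symmetric]) (simp only: \<Phi>_def app clip(2)[OF that])
    thus ?thesis by (simp add: pic_def \<theta>_def flip: exp_add mult.assoc)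
  qed
  show ?thesis
  proof
    show "\<theta> a = x0" by (simp add: \<theta>_def)
    fix t assume t: "t \<in> {a..b}"
    have "(\<theta> has_real_derivative rhs g t) (at t within {a..b})"
      unfolding \<theta>_def
      by (auto intro!: derivative_eq_intros integral_has_real_derivative cont_rhs t)
    thus "(\<theta> has_real_derivative f t (\<theta> t)) (at t within {a..b})"
      using \<theta>[OF t] by (simp add: rhs_def)
  qed
qed

section \<open>Positive and negative part of the sine\<close>

definition pos_sin :: "real \<Rightarrow> real" where "pos_sin x = max (sin x) 0"
definition neg_sin :: "real \<Rightarrow> real" where "neg_sin x = max (- sin x) 0"

lemma sin_split: "pos_sin x * neg_sin x = 0" "pos_sin x - neg_sin x = sin x"
  by (auto simp: pos_sin_def neg_sin_def max_def)

lemma pos_neg_sin_shift [simp]: "pos_sin (x - pi) = neg_sin x" "neg_sin (x - pi) = pos_sin x"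
  by (simp_all add: pos_sin_def neg_sin_def)

lemma pos_neg_sin_bounds:
  "0 \<le> pos_sin x" "pos_sin x \<le> 1" "0 \<le> neg_sin x" "neg_sin x \<le> 1"
  using sin_ge_minus_one[of x] by (auto simp: pos_sin_def neg_sin_def)

lemma pos_neg_sin_between:
  assumes "0 \<le> x" "x \<le> pi"
  shows "pos_sin x = sin x" "neg_sin x = 0"
  using sin_ge_zero[OF assms] by (auto simp: pos_sin_def neg_sin_def)

lemma continuous_on_pos_neg_sin [continuous_intros]:
  fixes f :: "'a::t2_space \<Rightarrow> real"
  assumes "continuous_on S f"
  shows "continuous_on S (\<lambda>x. pos_sin (f x))" "continuous_on S (\<lambda>x. neg_sin (f x))"
  unfolding pos_sin_def neg_sin_def by (intro continuous_intros continuous_on_sin assms)+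

lemma lipschitz_square:
  fixes f :: "real \<Rightarrow> real"
  assumes "\<And>x. \<bar>f x\<bar> \<le> 1" "\<bar>f x - f y\<bar> \<le> \<bar>x - y\<bar>"
  shows "\<bar>(f x)\<^sup>2 - (f y)\<^sup>2\<bar> \<le> 2 * \<bar>x - y\<bar>"
proof -
  have "\<bar>(f x)\<^sup>2 - (f y)\<^sup>2\<bar> = \<bar>f x + f y\<bar> * \<bar>f x - f y\<bar>"
    unfolding abs_mult[symmetric] by (rule arg_cong[of _ _ abs]) (simp add: power2_eq_square algebra_simps)
  also have "\<dots> \<le> 2 * \<bar>x - y\<bar>"
    using assms(1)[of x] assms(1)[of y] by (intro mult_mono assms(2)) auto
  finally show ?thesis .
qed

lemma abs_sin_diff_le: "\<bar>sin x - sin y\<bar> \<le> \<bar>x - y\<bar>" for x y :: real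
proof -
  have "\<bar>sin x - sin y\<bar> = 2 * \<bar>sin ((x - y) / 2)\<bar> * \<bar>cos ((x + y) / 2)\<bar>"
    by (simp add: sin_diff_sin abs_mult)
  also have "\<dots> \<le> 2 * \<bar>(x - y) / 2\<bar> * 1"
    by (intro mult_mono abs_sin_x_le_abs_x) auto
  finally show ?thesis by simp
qed

lemma abs_cos_diff_le: "\<bar>cos x - cos y\<bar> \<le> \<bar>x - y\<bar>" for x y :: real
  using abs_sin_diff_le[of "x + pi/2" "y + pi/2"] by (simp add: sin_add)

lemma trig_squares_lipschitz:
  "\<bar>(cos x)\<^sup>2 - (cos y)\<^sup>2\<bar> \<le> 2 * \<bar>x - y\<bar>" "\<bar>(sin x)\<^sup>2 - (sin y)\<^sup>2\<bar> \<le> 2 * \<bar>x - y\<bar>"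
  "\<bar>(pos_sin x)\<^sup>2 - (pos_sin y)\<^sup>2\<bar> \<le> 2 * \<bar>x - y\<bar>"
  "\<bar>(neg_sin x)\<^sup>2 - (neg_sin y)\<^sup>2\<bar> \<le> 2 * \<bar>x - y\<bar>" for x y :: real
proof -
  have "\<bar>pos_sin x - pos_sin y\<bar> \<le> \<bar>x - y\<bar>" "\<bar>neg_sin x - neg_sin y\<bar> \<le> \<bar>x - y\<bar>"
    using abs_sin_diff_le[of x y] unfolding pos_sin_def neg_sin_def by linarith+
  thus "\<bar>(cos x)\<^sup>2 - (cos y)\<^sup>2\<bar> \<le> 2 * \<bar>x - y\<bar>" "\<bar>(sin x)\<^sup>2 - (sin y)\<^sup>2\<bar> \<le> 2 * \<bar>x - y\<bar>"
    "\<bar>(pos_sin x)\<^sup>2 - (pos_sin y)\<^sup>2\<bar> \<le> 2 * \<bar>x - y\<bar>"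
    "\<bar>(neg_sin x)\<^sup>2 - (neg_sin y)\<^sup>2\<bar> \<le> 2 * \<bar>x - y\<bar>"
    by (intro lipschitz_square abs_cos_diff_le abs_sin_diff_le abs_sin_le_one abs_cos_le_one;
        simp add: pos_neg_sin_bounds)+
qed

section \<open>Derivatives relative to a compact interval\<close>

lemma deriv_Icc_eqI:
  assumes "T1 < T2" "t \<in> {T1..T2}" "(f has_real_derivative d) (at t within {T1..T2})"
  shows "deriv_Icc T1 T2 f t = d"
  unfolding deriv_Icc_def
  by (rule vector_derivative_within_closed_interval)
     (use assms in \<open>auto simp: has_real_derivative_iff_has_vector_derivative\<close>)

lemma C1_Icc_D:
  assumes "T1 < T2" "C1_Icc T1 T2 f" "t \<in> {T1..T2}"
  shows "(f has_real_derivative deriv_Icc T1 T2 f t) (at t within {T1..T2})"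
proof -
  have "f differentiable (at t within {T1..T2})"
    using assms by (auto simp: C1_Icc_def differentiable_on_def)
  then obtain d where "(f has_real_derivative d) (at t within {T1..T2})"
    by (auto simp: real_differentiable_def)
  with deriv_Icc_eqI[OF assms(1,3) this] show ?thesis by simp
qed

lemma C1_Icc_I:
  assumes "T1 < T2" "\<And>t. t \<in> {T1..T2} \<Longrightarrow> (f has_real_derivative f' t) (at t within {T1..T2})"
    and "continuous_on {T1..T2} f'"
  shows "C1_Icc T1 T2 f"
proof -
  have "continuous_on {T1..T2} (deriv_Icc T1 T2 f)"
    using assms(3) by (rule continuous_on_eq) (use deriv_Icc_eqI[OF assms(1) _ assms(2)] in simp)
  moreover have "f differentiable_on {T1..T2}"
    using assms(2) unfolding differentiable_on_def real_differentiable_def by blast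
  ultimately show ?thesis by (simp add: C1_Icc_def)
qed

section \<open>The Pruefer angle\<close>

locale sturm_liouville =
  fixes T1 T2 :: real and p q :: "real \<Rightarrow> real"
  assumes T: "T1 < T2"
    and cont_p: "continuous_on {T1..T2} p" and cont_q: "continuous_on {T1..T2} q"
    and p_pos: "\<And>t. t \<in> {T1..T2} \<Longrightarrow> p t > 0"
    and q_nonneg: "\<And>t. t \<in> {T1..T2} \<Longrightarrow> q t \<ge> 0"
begin

lemma cont_inverse_p: "continuous_on {T1..T2} (\<lambda>t. 1 / p t)"
  using p_pos by (intro continuous_intros cont_p) force

text \<open>
  The angle of \<open>(p u', u)\<close> in the plane: if \<open>u = r sin \<theta>\<close> and \<open>p u' = r cos \<theta>\<close> with \<open>r > 0\<close>, then
  \<open>- (p u')' + q u = M u\<^sup>+ - N u\<^sup>-\<close> decouples into \<open>\<theta>' = prufer_field M N t \<theta>\<close> and a linear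
  equation for \<open>r\<close>. Since \<open>u\<^sup>+\<close> and \<open>u\<^sup>-\<close> are positively homogeneous, the amplitude does not enter
  the equation for the angle.
\<close>

definition prufer_field :: "(real \<Rightarrow> real) \<Rightarrow> (real \<Rightarrow> real) \<Rightarrow> real \<Rightarrow> real \<Rightarrow> real" where
  "prufer_field M N t x =
     (cos x)\<^sup>2 / p t - q t * (sin x)\<^sup>2 + M t * (pos_sin x)\<^sup>2 + N t * (neg_sin x)\<^sup>2"

definition prufer :: "(real \<Rightarrow> real) \<Rightarrow> (real \<Rightarrow> real) \<Rightarrow> (real \<Rightarrow> real) \<Rightarrow> bool" where
  "prufer M N \<theta> \<longleftrightarrow> (\<forall>t\<in>{T1..T2}.
     (\<theta> has_real_derivative prufer_field M N t (\<theta> t)) (at t within {T1..T2}))"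

lemma pruferD:
  "prufer M N \<theta> \<Longrightarrow> t \<in> {T1..T2} \<Longrightarrow>
     (\<theta> has_real_derivative prufer_field M N t (\<theta> t)) (at t within {T1..T2})"
  by (simp add: prufer_def)

lemma prufer_interior:
  "prufer M N \<theta> \<Longrightarrow> T1 < t \<Longrightarrow> t < T2 \<Longrightarrow> (\<theta> has_real_derivative prufer_field M N t (\<theta> t)) (at t)"
  using pruferD[of M N \<theta> t] by (simp add: at_within_Icc_at)

lemma prufer_continuous: "prufer M N \<theta> \<Longrightarrow> continuous_on {T1..T2} \<theta>"
  by (rule DERIV_continuous_on[OF pruferD])

text \<open>
  Turning the angle by \<open>\<pi>\<close> changes the sign of \<open>u\<close>, which exchanges the two weights. This is what
  lets inductions over half-turns treat one half-turn at a time.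
\<close>

lemma prufer_shift:
  assumes "prufer M N \<theta>"
  shows "prufer N M (\<lambda>t. \<theta> t - pi)"
  unfolding prufer_def
proof
  fix t assume "t \<in> {T1..T2}"
  from pruferD[OF assms this]
  have "((\<lambda>t. \<theta> t - pi) has_real_derivative prufer_field M N t (\<theta> t) - 0) (at t within {T1..T2})"
    by (intro derivative_intros)
  thus "((\<lambda>t. \<theta> t - pi) has_real_derivative prufer_field N M t (\<theta> t - pi)) (at t within {T1..T2})"
    by (simp add: prufer_field_def add_ac)
qed

lemma prufer_field_lipschitz:
  assumes "continuous_on {T1..T2} M" "continuous_on {T1..T2} N"
  obtains L where "L > 0" "\<And>t x y. t \<in> {T1..T2} \<Longrightarrow>
    \<bar>prufer_field M N t x - prufer_field M N t y\<bar> \<le> L * \<bar>x - y\<bar>"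
proof -
  have "continuous_on {T1..T2} (\<lambda>t. 2 * (1 / p t + q t + \<bar>M t\<bar> + \<bar>N t\<bar>))"
    by (intro continuous_intros cont_inverse_p cont_q assms)
  from continuous_on_Icc_bounded[OF this] obtain L where L: "L > 0"
      "\<And>t. t \<in> {T1..T2} \<Longrightarrow> \<bar>2 * (1 / p t + q t + \<bar>M t\<bar> + \<bar>N t\<bar>)\<bar> \<le> L"
    by blast
  show ?thesis
  proof (rule that[OF L(1)])
    fix t x y assume t: "t \<in> {T1..T2}"
    have "\<bar>prufer_field M N t x - prufer_field M N t y\<bar>
      = \<bar>(1 / p t) * ((cos x)\<^sup>2 - (cos y)\<^sup>2) - q t * ((sin x)\<^sup>2 - (sin y)\<^sup>2)
        + M t * ((pos_sin x)\<^sup>2 - (pos_sin y)\<^sup>2) + N t * ((neg_sin x)\<^sup>2 - (neg_sin y)\<^sup>2)\<bar>"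
      by (simp add: prufer_field_def algebra_simps diff_divide_distrib)
    also have "\<dots> \<le> \<bar>(1 / p t) * ((cos x)\<^sup>2 - (cos y)\<^sup>2)\<bar> + \<bar>q t * ((sin x)\<^sup>2 - (sin y)\<^sup>2)\<bar>
        + \<bar>M t * ((pos_sin x)\<^sup>2 - (pos_sin y)\<^sup>2)\<bar> + \<bar>N t * ((neg_sin x)\<^sup>2 - (neg_sin y)\<^sup>2)\<bar>"
      by linarith
    also have "\<dots> \<le> \<bar>1 / p t\<bar> * (2 * \<bar>x - y\<bar>) + \<bar>q t\<bar> * (2 * \<bar>x - y\<bar>)
        + \<bar>M t\<bar> * (2 * \<bar>x - y\<bar>) + \<bar>N t\<bar> * (2 * \<bar>x - y\<bar>)"
      unfolding abs_mult[of "1 / p t"] abs_mult[of "q t"] abs_mult[of "M t"] abs_mult[of "N t"]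
      by (intro add_mono mult_left_mono trig_squares_lipschitz) auto
    also have "\<dots> = 2 * (1 / p t + q t + \<bar>M t\<bar> + \<bar>N t\<bar>) * \<bar>x - y\<bar>"
      using p_pos[OF t] q_nonneg[OF t] by (simp add: algebra_simps)
    also have "\<dots> \<le> L * \<bar>x - y\<bar>"
      using L(2)[OF t] by (intro mult_right_mono) auto
    finally show "\<bar>prufer_field M N t x - prufer_field M N t y\<bar> \<le> L * \<bar>x - y\<bar>" .
  qed
qed

lemma prufer_exists:
  assumes "continuous_on {T1..T2} M" "continuous_on {T1..T2} N"
  obtains \<theta> where "\<theta> T1 = 0" "prufer M N \<theta>"
proof -
  obtain L where L: "L > 0" "\<And>t x y. t \<in> {T1..T2} \<Longrightarrow>
    \<bar>prufer_field M N t x - prufer_field M N t y\<bar> \<le> L * \<bar>x - y\<bar>"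
    using prufer_field_lipschitz[OF assms] by metis
  have fst: "continuous_on ({T1..T2} \<times> UNIV) (\<lambda>z. f (fst z))"
    if "continuous_on {T1..T2} f" for f :: "real \<Rightarrow> real"
    by (rule continuous_on_compose2[OF that]) (intro continuous_intros, auto)
  have "continuous_on ({T1..T2} \<times> UNIV) (\<lambda>(t, x). prufer_field M N t x)"
    unfolding prufer_field_def case_prod_beta
    by (intro continuous_intros fst cont_p cont_q assms) (use p_pos in force)
  from ode_exists[OF less_imp_le[OF T] L(1) this L(2), of 0] show ?thesis
    using that unfolding prufer_def by metis
qed

text \<open>
  The function \<open>h = (\<theta> - \<eta>)\<^sup>2 + \<epsilon>\<^sup>2\<close> is differentiable and satisfies \<open>h' \<le> (2 L + 1) h\<close>, because
  \<open>2 \<bar>\<theta> - \<eta>\<bar> \<epsilon> \<le> (\<theta> - \<eta>)\<^sup>2 + \<epsilon>\<^sup>2\<close>. This gives continuity of the final angle in the weights.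
\<close>

lemma prufer_gronwall:
  assumes \<theta>: "prufer M N \<theta>" and \<eta>: "prufer M' N' \<eta>" and init: "\<theta> T1 = \<eta> T1"
    and L: "\<And>t x y. t \<in> {T1..T2} \<Longrightarrow>
      \<bar>prufer_field M N t x - prufer_field M N t y\<bar> \<le> L * \<bar>x - y\<bar>"
    and \<epsilon>: "\<And>t x. t \<in> {T1..T2} \<Longrightarrow> \<bar>prufer_field M N t x - prufer_field M' N' t x\<bar> \<le> \<epsilon>"
  shows "(\<theta> T2 - \<eta> T2)\<^sup>2 \<le> \<epsilon>\<^sup>2 * exp ((2 * L + 1) * (T2 - T1))"
proof -
  define h where "h t = (\<theta> t - \<eta> t)\<^sup>2 + \<epsilon>\<^sup>2" for t
  have "L \<ge> 0"
    using L[of T1 0 1] T by (auto intro: order_trans[OF abs_ge_zero])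
  have "h T2 \<le> h T1 * exp ((2 * L + 1) * (T2 - T1))"
  proof (rule gronwall)
    show "continuous_on {T1..T2} h" unfolding h_def
      by (intro continuous_intros prufer_continuous[OF \<theta>] prufer_continuous[OF \<eta>])
    fix t assume t: "T1 < t" "t < T2"
    let ?F = "prufer_field M N t (\<theta> t)" and ?G = "prufer_field M' N' t (\<eta> t)"
    show "(h has_real_derivative 2 * (\<theta> t - \<eta> t) * (?F - ?G)) (at t)"
      unfolding h_def
      by (auto intro!: derivative_eq_intros prufer_interior[OF \<theta>] prufer_interior[OF \<eta>] t)
    have "\<bar>?F - ?G\<bar> \<le> L * \<bar>\<theta> t - \<eta> t\<bar> + \<epsilon>"
      using L[of t "\<theta> t" "\<eta> t"] \<epsilon>[of t "\<eta> t"] t by auto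
    hence "\<bar>\<theta> t - \<eta> t\<bar> * \<bar>?F - ?G\<bar> \<le> \<bar>\<theta> t - \<eta> t\<bar> * (L * \<bar>\<theta> t - \<eta> t\<bar> + \<epsilon>)"
      by (intro mult_left_mono) auto
    moreover have "(\<theta> t - \<eta> t) * (?F - ?G) \<le> \<bar>\<theta> t - \<eta> t\<bar> * \<bar>?F - ?G\<bar>"
      by (metis abs_ge_self abs_mult)
    moreover have "\<bar>\<theta> t - \<eta> t\<bar> * (L * \<bar>\<theta> t - \<eta> t\<bar> + \<epsilon>) = L * (\<theta> t - \<eta> t)\<^sup>2 + \<bar>\<theta> t - \<eta> t\<bar> * \<epsilon>"
      by (simp add: algebra_simps power2_eq_square)
    moreover have "2 * (\<bar>\<theta> t - \<eta> t\<bar> * \<epsilon>) \<le> (\<theta> t - \<eta> t)\<^sup>2 + \<epsilon>\<^sup>2"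
      using sum_squares_bound[of "\<bar>\<theta> t - \<eta> t\<bar>" \<epsilon>] by simp
    moreover have "(2 * L + 1) * h t = 2 * (L * (\<theta> t - \<eta> t)\<^sup>2) + 2 * (L * \<epsilon>\<^sup>2) + (\<theta> t - \<eta> t)\<^sup>2 + \<epsilon>\<^sup>2"
      by (simp add: h_def algebra_simps)
    moreover have "0 \<le> L * \<epsilon>\<^sup>2" using \<open>L \<ge> 0\<close> by simp
    ultimately show "2 * (\<theta> t - \<eta> t) * (?F - ?G) \<le> (2 * L + 1) * h t"
      by linarith
  qed (use T in simp)
  moreover have "(\<theta> T2 - \<eta> T2)\<^sup>2 \<le> h T2" "h T1 = \<epsilon>\<^sup>2" using init by (auto simp: h_def)
  ultimately show ?thesis by simp
qed

text \<open>
  At a multiple of \<open>\<pi>\<close> the sine vanishes and the angle has velocity \<open>1 / p t > 0\<close>, whatever the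
  weights are: the zeros of \<open>u\<close> are crossed in one direction only.
\<close>

lemma prufer_above_multiple_of_pi:
  assumes "prufer M N \<theta>" "T1 \<le> s" "s < t" "t \<le> T2" "\<theta> s \<ge> of_nat j * pi"
  shows "\<theta> t > of_nat j * pi"
proof -
  have "0 < \<theta> t - of_nat j * pi"
  proof (rule positive_after_upward_crossing[of s t "\<lambda>x. \<theta> x - of_nat j * pi"
        "\<lambda>x. prufer_field M N x (\<theta> x)"])
    fix \<tau> assume \<tau>: "\<tau> \<in> {s..t}"
    have "(\<theta> has_real_derivative prufer_field M N \<tau> (\<theta> \<tau>)) (at \<tau> within {s..t})"
      by (rule DERIV_subset[OF pruferD[OF assms(1)]]) (use \<tau> assms in auto)
    thus "((\<lambda>x. \<theta> x - of_nat j * pi) has_real_derivative prufer_field M N \<tau> (\<theta> \<tau>)) (at \<tau> within {s..t})"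
      by (auto intro!: derivative_eq_intros)
    assume "\<theta> \<tau> - of_nat j * pi = 0"
    hence eq: "\<theta> \<tau> = of_nat j * pi" by simp
    have "(cos (of_nat j * pi :: real))\<^sup>2 = 1"
      by (simp add: cos_npi power_mult_distrib flip: power_mult)
    thus "0 < prufer_field M N \<tau> (\<theta> \<tau>)"
      using p_pos[of \<tau>] \<tau> assms unfolding eq
      by (simp add: prufer_field_def pos_sin_def neg_sin_def sin_npi)
  qed (use assms in auto)
  thus ?thesis by simp
qed

end

section \<open>From angles to solutions and back\<close>

text \<open>
  These identities express that \<open>(r sin \<theta>)' = r cos \<theta> / p\<close> and
  \<open>(r cos \<theta>)' = q r sin \<theta> - (M (r sin \<theta>)\<^sup>+ - N (r sin \<theta>)\<^sup>-)\<close> when \<open>r' / r\<close> is the first factor on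
  the left. Here \<open>s\<close>, \<open>c\<close> are sine and cosine, \<open>P\<close>, \<open>R\<close> the positive and negative part of \<open>s\<close>,
  and \<open>k\<close>, \<open>l\<close> stand for \<open>1 / p\<close> and \<open>q\<close>.
\<close>

lemma prufer_identities:
  fixes s c P R k l M N :: real
  assumes "s = P - R" "P * R = 0" "c\<^sup>2 + s\<^sup>2 = 1"
  shows "((k + l) * s * c - (M * P - N * R) * c) * s
      + c * (c\<^sup>2 * k - l * s\<^sup>2 + M * P\<^sup>2 + N * R\<^sup>2) = c * k"
    and "((k + l) * s * c - (M * P - N * R) * c) * c
      - s * (c\<^sup>2 * k - l * s\<^sup>2 + M * P\<^sup>2 + N * R\<^sup>2) = l * s - (M * P - N * R)"
  using assms by algebra+

context sturm_liouville
begin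

text \<open>
  The first-order system for \<open>u\<close> and the flux \<open>v = p u'\<close>. As in the boundary value problem, the
  differential equation is imposed in the open interval only.
\<close>

definition sl_system ::
  "(real \<Rightarrow> real) \<Rightarrow> (real \<Rightarrow> real) \<Rightarrow> (real \<Rightarrow> real) \<Rightarrow> (real \<Rightarrow> real) \<Rightarrow> bool" where
  "sl_system M N u v \<longleftrightarrow> continuous_on {T1..T2} u \<and> continuous_on {T1..T2} v \<and>
     (\<forall>t\<in>{T1<..<T2}. (u has_real_derivative v t / p t) (at t) \<and>
        (v has_real_derivative q t * u t - (M t * pos_part u t - N t * neg_part u t)) (at t))"

lemma prufer_amplitude:
  assumes \<theta>: "prufer M N \<theta>" and M: "continuous_on {T1..T2} M" and N: "continuous_on {T1..T2} N"
    and "c > 0"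
  obtains r where "\<And>t. r t > 0" "r T1 = c"
    "\<And>t. t \<in> {T1..T2} \<Longrightarrow>
       ((\<lambda>t. r t * sin (\<theta> t)) has_real_derivative r t * cos (\<theta> t) / p t) (at t within {T1..T2})"
    "\<And>t. t \<in> {T1..T2} \<Longrightarrow>
       ((\<lambda>t. r t * cos (\<theta> t)) has_real_derivative
         q t * (r t * sin (\<theta> t)) - (M t * pos_part (\<lambda>t. r t * sin (\<theta> t)) t
           - N t * neg_part (\<lambda>t. r t * sin (\<theta> t)) t)) (at t within {T1..T2})"
proof -
  \<comment> \<open>the logarithmic derivative \<open>(u u' + v v') / (u\<^sup>2 + v\<^sup>2)\<close> of the amplitude\<close>
  define \<rho> where "\<rho> t = (1 / p t + q t) * sin (\<theta> t) * cos (\<theta> t)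
    - (M t * pos_sin (\<theta> t) - N t * neg_sin (\<theta> t)) * cos (\<theta> t)" for t
  define r where "r t = c * exp (integral {T1..t} \<rho>)" for t
  have "continuous_on {T1..T2} \<rho>"
    unfolding \<rho>_def by (intro continuous_intros cont_inverse_p cont_q M N prufer_continuous[OF \<theta>])
  hence r': "(r has_real_derivative r t * \<rho> t) (at t within {T1..T2})" if "t \<in> {T1..T2}" for t
    unfolding r_def using that by (auto intro!: derivative_eq_intros integral_has_real_derivative)
  have r_pos: "r t > 0" for t using \<open>c > 0\<close> by (simp add: r_def)
  show ?thesis
  proof
    show "r T1 = c" by (simp add: r_def)
    show "r t > 0" for t by (fact r_pos)
    fix t assume t: "t \<in> {T1..T2}"
    let ?F = "prufer_field M N t (\<theta> t)" and ?s = "sin (\<theta> t)" and ?c = "cos (\<theta> t)"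
    let ?P = "pos_sin (\<theta> t)" and ?N = "neg_sin (\<theta> t)"
    have parts: "pos_part (\<lambda>t. r t * sin (\<theta> t)) t = r t * ?P"
      "neg_part (\<lambda>t. r t * sin (\<theta> t)) t = r t * ?N"
      using r_pos[of t] by (auto simp: pos_part_def neg_part_def pos_sin_def neg_sin_def max_def
          zero_le_mult_iff mult_le_0_iff)
    have PN: "?s = ?P - ?N" "?P * ?N = 0" using sin_split[of "\<theta> t"] by simp_all
    have one: "?c\<^sup>2 + ?s\<^sup>2 = 1" by simp
    have u': "\<rho> t * ?s + ?c * ?F = ?c / p t"
      using prufer_identities(1)[OF PN one, of "1 / p t" "q t" "M t" "N t"]
      by (simp add: \<rho>_def prufer_field_def)
    have v': "\<rho> t * ?c - ?s * ?F = q t * ?s - (M t * ?P - N t * ?N)"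
      using prufer_identities(2)[OF PN one, of "1 / p t" "q t" "M t" "N t"]
      by (simp add: \<rho>_def prufer_field_def)
    have "((\<lambda>t. r t * sin (\<theta> t)) has_real_derivative r t * (\<rho> t * ?s + ?c * ?F)) (at t within {T1..T2})"
      by (auto intro!: derivative_eq_intros r'[OF t] pruferD[OF \<theta> t] simp: algebra_simps)
    thus "((\<lambda>t. r t * sin (\<theta> t)) has_real_derivative r t * cos (\<theta> t) / p t) (at t within {T1..T2})"
      unfolding u' by simp
    have "((\<lambda>t. r t * cos (\<theta> t)) has_real_derivative r t * (\<rho> t * ?c - ?s * ?F)) (at t within {T1..T2})"
      by (auto intro!: derivative_eq_intros r'[OF t] pruferD[OF \<theta> t] simp: algebra_simps)
    thus "((\<lambda>t. r t * cos (\<theta> t)) has_real_derivative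
         q t * (r t * sin (\<theta> t)) - (M t * pos_part (\<lambda>t. r t * sin (\<theta> t)) t
           - N t * neg_part (\<lambda>t. r t * sin (\<theta> t)) t)) (at t within {T1..T2})"
      unfolding v' parts by (simp add: algebra_simps)
  qed
qed

text \<open>
  The right-hand side is Lipschitz in \<open>(u, v)\<close>, since \<open>u \<mapsto> u\<^sup>+\<close> and \<open>u \<mapsto> u\<^sup>-\<close> are; the squared
  distance of two solutions is thus controlled by Gronwall's inequality.
\<close>

lemma sl_system_unique:
  assumes M: "continuous_on {T1..T2} M" and N: "continuous_on {T1..T2} N"
    and u: "sl_system M N u v" and w: "sl_system M N w z"
    and init: "u T1 = w T1" "v T1 = z T1" and t: "t \<in> {T1..T2}"
  shows "u t = w t"
proof -
  have "continuous_on {T1..T2} (\<lambda>t. 1 / p t + q t + \<bar>M t\<bar> + \<bar>N t\<bar>)"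
    by (intro continuous_intros cont_inverse_p cont_q M N)
  from continuous_on_Icc_bounded[OF this] obtain K where K: "K > 0"
      "\<And>t. t \<in> {T1..T2} \<Longrightarrow> \<bar>1 / p t + q t + \<bar>M t\<bar> + \<bar>N t\<bar>\<bar> \<le> K"
    by blast
  define h where "h t = (u t - w t)\<^sup>2 + (v t - z t)\<^sup>2" for t
  have "continuous_on {T1..T2} h" unfolding h_def
    using u w by (intro continuous_intros) (auto simp: sl_system_def)
  define g where "g u t = q t * u t - (M t * pos_part u t - N t * neg_part u t)" for u t
  have "h t \<le> h T1 * exp (K * (t - T1))"
  proof (rule gronwall)
    show "continuous_on {T1..t} h"
      by (rule continuous_on_subset[OF \<open>continuous_on {T1..T2} h\<close>]) (use t in auto)
    fix x assume x: "T1 < x" "x < t"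
    hence x': "x \<in> {T1<..<T2}" "x \<in> {T1..T2}" using t by auto
    have der: "(u has_real_derivative v x / p x) (at x)" "(v has_real_derivative g u x) (at x)"
      "(w has_real_derivative z x / p x) (at x)" "(z has_real_derivative g w x) (at x)"
      using u w x' by (auto simp: sl_system_def g_def)
    let ?du = "u x - w x" and ?dv = "v x - z x"
    show "(h has_real_derivative 2 * ?du * (v x / p x - z x / p x) + 2 * ?dv * (g u x - g w x)) (at x)"
      unfolding h_def by (auto intro!: derivative_eq_intros der simp: algebra_simps diff_divide_distrib add_divide_distrib)
    have "\<bar>pos_part u x - pos_part w x\<bar> \<le> \<bar>?du\<bar>" "\<bar>neg_part u x - neg_part w x\<bar> \<le> \<bar>?du\<bar>"
      unfolding pos_part_def neg_part_def by linarith+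
    hence "\<bar>M x * (pos_part u x - pos_part w x)\<bar> \<le> \<bar>M x\<bar> * \<bar>?du\<bar>"
      "\<bar>N x * (neg_part u x - neg_part w x)\<bar> \<le> \<bar>N x\<bar> * \<bar>?du\<bar>"
      by (auto simp: abs_mult intro: mult_left_mono)
    moreover have "g u x - g w x = q x * ?du - M x * (pos_part u x - pos_part w x)
        + N x * (neg_part u x - neg_part w x)"
      by (simp add: g_def algebra_simps)
    moreover have "\<bar>q x * ?du\<bar> = q x * \<bar>?du\<bar>"
      using q_nonneg[OF x'(2)] by (simp add: abs_mult)
    ultimately have "\<bar>g u x - g w x\<bar> \<le> q x * \<bar>?du\<bar> + \<bar>M x\<bar> * \<bar>?du\<bar> + \<bar>N x\<bar> * \<bar>?du\<bar>"
      by linarith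
    hence "\<bar>?dv\<bar> * \<bar>g u x - g w x\<bar> \<le> \<bar>?dv\<bar> * (q x * \<bar>?du\<bar> + \<bar>M x\<bar> * \<bar>?du\<bar> + \<bar>N x\<bar> * \<bar>?du\<bar>)"
      by (intro mult_left_mono) auto
    hence "?dv * (g u x - g w x) \<le> (q x + \<bar>M x\<bar> + \<bar>N x\<bar>) * (\<bar>?du\<bar> * \<bar>?dv\<bar>)"
      using abs_ge_self[of "?dv * (g u x - g w x)"] unfolding abs_mult
      by (elim order_trans) (simp add: algebra_simps)
    moreover have "?du * (v x / p x - z x / p x) \<le> 1 / p x * (\<bar>?du\<bar> * \<bar>?dv\<bar>)"
    proof -
      have "?du * (v x / p x - z x / p x) = 1 / p x * (?du * ?dv)"
        by (simp add: diff_divide_distrib algebra_simps)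
      also have "\<dots> \<le> 1 / p x * (\<bar>?du\<bar> * \<bar>?dv\<bar>)"
        using p_pos[OF x'(2)] abs_ge_self[of "?du * ?dv"] unfolding abs_mult
        by (intro mult_left_mono) auto
      finally show ?thesis .
    qed
    ultimately have "2 * ?du * (v x / p x - z x / p x) + 2 * ?dv * (g u x - g w x)
        \<le> 2 * (1 / p x * (\<bar>?du\<bar> * \<bar>?dv\<bar>)) + 2 * ((q x + \<bar>M x\<bar> + \<bar>N x\<bar>) * (\<bar>?du\<bar> * \<bar>?dv\<bar>))"
      unfolding mult.assoc[of 2] by (intro add_mono mult_left_mono) simp_all
    also have "\<dots> = (1 / p x + q x + \<bar>M x\<bar> + \<bar>N x\<bar>) * (2 * (\<bar>?du\<bar> * \<bar>?dv\<bar>))"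
      by (simp add: algebra_simps)
    also have "\<dots> \<le> K * (2 * (\<bar>?du\<bar> * \<bar>?dv\<bar>))"
      using K(2)[OF x'(2)] by (intro mult_right_mono) auto
    also have "\<dots> \<le> K * h x"
      using K(1) sum_squares_bound[of "\<bar>?du\<bar>" "\<bar>?dv\<bar>"] by (intro mult_left_mono) (auto simp: h_def)
    finally show "2 * ?du * (v x / p x - z x / p x) + 2 * ?dv * (g u x - g w x) \<le> K * h x" .
  qed (use t in auto)
  hence "h t \<le> 0" using init by (simp add: h_def)
  thus ?thesis by (simp add: h_def sum_power2_le_zero_iff)
qed

lemma prufer_level_unique:
  assumes "prufer M N \<theta>" "s \<in> {T1..T2}" "t \<in> {T1..T2}" "\<theta> s = of_nat j * pi" "\<theta> t = of_nat j * pi"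
  shows "s = t"
  using prufer_above_multiple_of_pi[OF assms(1), of s t j]
    prufer_above_multiple_of_pi[OF assms(1), of t s j] assms
  by (cases s t rule: linorder_cases) auto

text \<open>
  The interior zeros are the times \<open>z j\<close> at which the angle passes \<open>j \<pi>\<close> for \<open>0 < j < k\<close>; each of
  them exists by the intermediate value theorem and is unique as crossings are upward.
\<close>

lemma prufer_zeros:
  assumes \<theta>: "prufer M N \<theta>" "\<theta> T1 = 0" "\<theta> T2 = of_nat k * pi"
  shows "exactly_zeros T1 T2 (k - 1) (\<lambda>t. sin (\<theta> t))"
proof -
  have "\<exists>t\<in>{T1<..<T2}. \<theta> t = of_nat j * pi" if "0 < j" "j < k" for j
  proof -
    from that have "\<theta> T1 < of_nat j * pi" "of_nat j * pi < \<theta> T2" using \<theta> by simp_all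
    moreover then obtain t where "T1 \<le> t" "t \<le> T2" "\<theta> t = of_nat j * pi"
      using IVT'[of \<theta> T1 "of_nat j * pi" T2] prufer_continuous[OF \<theta>(1)] T by auto
    ultimately show ?thesis
      by (intro bexI[of _ t]) (auto simp: less_le)
  qed
  then obtain z where z: "\<And>j. 0 < j \<Longrightarrow> j < k \<Longrightarrow> z j \<in> {T1<..<T2} \<and> \<theta> (z j) = of_nat j * pi"
    by metis
  have "{t\<in>{T1<..<T2}. sin (\<theta> t) = 0} = z ` {1..<k}"
  proof (intro equalityI subsetI)
    fix t assume t: "t \<in> {t\<in>{T1<..<T2}. sin (\<theta> t) = 0}"
    then obtain i :: int where i: "\<theta> t = of_int i * pi" by (auto simp: sin_zero_iff_int2)
    have "\<theta> t > 0" using prufer_above_multiple_of_pi[OF \<theta>(1), of T1 t 0] t \<theta>(2) by auto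
    hence "i > 0" using i by (simp add: zero_less_mult_iff)
    then obtain j where j: "i = int j" "0 < j" using zero_less_imp_eq_int by blast
    have "j < k"
    proof (rule ccontr)
      assume "\<not> j < k"
      hence "\<theta> t \<ge> of_nat k * pi" using i j by simp
      from prufer_above_multiple_of_pi[OF \<theta>(1) _ _ _ this, of T2] t \<theta>(3) show False by auto
    qed
    moreover have "t = z j"
      by (rule prufer_level_unique[OF \<theta>(1), of _ _ j]) (use t z[OF j(2) \<open>j < k\<close>] i j in auto)
    ultimately show "t \<in> z ` {1..<k}" using j by auto
  next
    fix t assume "t \<in> z ` {1..<k}"
    then obtain j where "j \<in> {1..<k}" "t = z j" by (rule imageE)
    with z[of j] show "t \<in> {t\<in>{T1<..<T2}. sin (\<theta> t) = 0}" by (auto simp: sin_npi)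
  qed
  moreover have "inj_on z {1..<k}"
  proof
    fix i j assume ij: "i \<in> {1..<k}" "j \<in> {1..<k}" "z i = z j"
    have "of_nat i * pi = \<theta> (z i)" "\<theta> (z j) = of_nat j * pi"
      using z[of i] z[of j] ij(1,2) by simp_all
    hence "of_nat i * pi = (of_nat j * pi :: real)" unfolding ij(3) by (rule trans)
    thus "i = j" by simp
  qed
  ultimately show ?thesis
    by (simp add: exactly_zeros_def card_image)
qed

lemma C_gt_of_angle:
  assumes m: "continuous_on {T1..T2} m" and n: "continuous_on {T1..T2} n"
    and \<theta>: "prufer (\<lambda>t. a * m t) (\<lambda>t. b * n t) \<theta>" "\<theta> T1 = 0" "\<theta> T2 = of_nat k * pi"
  shows "(a, b) \<in> C_gt T1 T2 p q m n k"
proof -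
  have M: "continuous_on {T1..T2} (\<lambda>t. a * m t)" and N: "continuous_on {T1..T2} (\<lambda>t. b * n t)"
    by (intro continuous_intros m n)+
  obtain r where r: "\<And>t. r t > 0" "r T1 = 1"
    and u': "\<And>t. t \<in> {T1..T2} \<Longrightarrow>
       ((\<lambda>t. r t * sin (\<theta> t)) has_real_derivative r t * cos (\<theta> t) / p t) (at t within {T1..T2})"
    and v': "\<And>t. t \<in> {T1..T2} \<Longrightarrow>
       ((\<lambda>t. r t * cos (\<theta> t)) has_real_derivative
         q t * (r t * sin (\<theta> t)) - (a * m t * pos_part (\<lambda>t. r t * sin (\<theta> t)) t
           - b * n t * neg_part (\<lambda>t. r t * sin (\<theta> t)) t)) (at t within {T1..T2})"
    by (rule prufer_amplitude[OF \<theta>(1) M N zero_less_one]) (rule that)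
  define u where "u t = r t * sin (\<theta> t)" for t
  define v where "v t = r t * cos (\<theta> t)" for t
  define v1 where "v1 t = q t * u t - (a * m t * pos_part u t - b * n t * neg_part u t)" for t
  have u': "(u has_real_derivative v t / p t) (at t within {T1..T2})" if "t \<in> {T1..T2}" for t
    using u'[OF that] by (simp add: u_def[abs_def] v_def)
  have v': "(v has_real_derivative v1 t) (at t within {T1..T2})" if "t \<in> {T1..T2}" for t
    using v'[OF that] unfolding v1_def u_def[abs_def] v_def[abs_def] .
  have cont: "continuous_on {T1..T2} u" "continuous_on {T1..T2} v"
    by (rule DERIV_continuous_on[OF u'] DERIV_continuous_on[OF v'], assumption)+
  have du: "deriv_Icc T1 T2 u t = v t / p t" if "t \<in> {T1..T2}" for t
    by (rule deriv_Icc_eqI[OF T that u'[OF that]])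
  have flux': "((\<lambda>t. p t * deriv_Icc T1 T2 u t) has_real_derivative v1 t) (at t within {T1..T2})"
    if t: "t \<in> {T1..T2}" for t
  proof (rule has_field_derivative_transform_within[OF v'[OF t] zero_less_one t])
    fix s assume s: "s \<in> {T1..T2}"
    show "v s = p s * deriv_Icc T1 T2 u s" using du[OF s] p_pos[OF s] by simp
  qed
  have "solves_P T1 T2 p q m n a b u"
    unfolding solves_P_def
  proof (intro conjI ballI)
    show "C1_Icc T1 T2 u"
      by (rule C1_Icc_I[OF T u']) (use p_pos in \<open>force intro!: continuous_intros cont cont_p\<close>)+
    have "continuous_on {T1..T2} v1"
      unfolding v1_def pos_part_def neg_part_def by (intro continuous_intros cont cont_q m n)
    thus "C1_Icc T1 T2 (\<lambda>t. p t * deriv_Icc T1 T2 u t)"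
      by (intro C1_Icc_I[OF T flux'])
    fix t assume "t \<in> {T1<..<T2}"
    hence t: "t \<in> {T1..T2}" by auto
    show "SL_op T1 T2 p q u t = a * m t * pos_part u t - b * n t * neg_part u t"
      unfolding SL_op_def deriv_Icc_eqI[OF T t flux'[OF t]] v1_def by simp
  qed (use \<theta> in \<open>auto simp: u_def sin_npi\<close>)
  moreover have "exactly_zeros T1 T2 (k - 1) u"
  proof -
    have "(u t = 0) = (sin (\<theta> t) = 0)" for t using r(1)[of t] by (simp add: u_def)
    thus ?thesis using prufer_zeros[OF \<theta>] by (simp add: exactly_zeros_def)
  qed
  moreover have "deriv_Icc T1 T2 u T1 > 0"
    using du[of T1] r(1)[of T1] p_pos[of T1] T \<theta>(2) by (simp add: v_def)
  ultimately show ?thesis by (auto simp: C_gt_def)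
qed

text \<open>
  By uniqueness a solution of the boundary value problem is \<open>r sin \<theta>\<close> with the amplitude normalized
  to match the initial flux. Its vanishing at \<open>T2\<close> forces a final angle \<open>j \<pi>\<close>, and the number of
  interior zeros identifies \<open>j\<close>.
\<close>

lemma angle_of_C_gt:
  assumes m: "continuous_on {T1..T2} m" and n: "continuous_on {T1..T2} n"
    and \<theta>: "prufer (\<lambda>t. a * m t) (\<lambda>t. b * n t) \<theta>" "\<theta> T1 = 0"
    and ab: "(a, b) \<in> C_gt T1 T2 p q m n k" and "k \<ge> 1"
  shows "\<theta> T2 = of_nat k * pi"
proof -
  from ab obtain u where u: "solves_P T1 T2 p q m n a b u" "exactly_zeros T1 T2 (k - 1) u"
      "deriv_Icc T1 T2 u T1 > 0"
    by (auto simp: C_gt_def)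
  have M: "continuous_on {T1..T2} (\<lambda>t. a * m t)" and N: "continuous_on {T1..T2} (\<lambda>t. b * n t)"
    by (intro continuous_intros m n)+
  define v where "v t = p t * deriv_Icc T1 T2 u t" for t
  have C1: "C1_Icc T1 T2 u" "C1_Icc T1 T2 v" using u(1) by (auto simp: solves_P_def v_def[abs_def])
  have sys: "sl_system (\<lambda>t. a * m t) (\<lambda>t. b * n t) u v"
    unfolding sl_system_def
  proof (intro conjI ballI)
    show "continuous_on {T1..T2} u" "continuous_on {T1..T2} v"
      by (rule DERIV_continuous_on[OF C1_Icc_D[OF T C1(1)]] DERIV_continuous_on[OF C1_Icc_D[OF T C1(2)]],
          assumption)+
    fix t assume t: "t \<in> {T1<..<T2}"
    hence t': "t \<in> {T1..T2}" by auto
    show "(u has_real_derivative v t / p t) (at t)"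
      using C1_Icc_D[OF T C1(1) t'] t p_pos[OF t'] by (simp add: v_def at_within_Icc_at)
    have "deriv_Icc T1 T2 v t = q t * u t - (a * m t * pos_part u t - b * n t * neg_part u t)"
      using u(1) t by (auto simp: solves_P_def SL_op_def v_def[abs_def] algebra_simps)
    thus "(v has_real_derivative q t * u t - (a * m t * pos_part u t - b * n t * neg_part u t)) (at t)"
      using C1_Icc_D[OF T C1(2) t'] t by (simp add: at_within_Icc_at)
  qed
  have "v T1 > 0" using u(3) p_pos[of T1] T by (simp add: v_def)
  obtain r where r: "\<And>t. r t > 0" "r T1 = v T1"
    and w': "\<And>t. t \<in> {T1..T2} \<Longrightarrow>
       ((\<lambda>t. r t * sin (\<theta> t)) has_real_derivative r t * cos (\<theta> t) / p t) (at t within {T1..T2})"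
    and z': "\<And>t. t \<in> {T1..T2} \<Longrightarrow>
       ((\<lambda>t. r t * cos (\<theta> t)) has_real_derivative
         q t * (r t * sin (\<theta> t)) - (a * m t * pos_part (\<lambda>t. r t * sin (\<theta> t)) t
           - b * n t * neg_part (\<lambda>t. r t * sin (\<theta> t)) t)) (at t within {T1..T2})"
    by (rule prufer_amplitude[OF \<theta>(1) M N \<open>v T1 > 0\<close>]) (rule that)
  have sys': "sl_system (\<lambda>t. a * m t) (\<lambda>t. b * n t) (\<lambda>t. r t * sin (\<theta> t)) (\<lambda>t. r t * cos (\<theta> t))"
    unfolding sl_system_def
  proof (intro conjI ballI)
    show "continuous_on {T1..T2} (\<lambda>t. r t * sin (\<theta> t))" "continuous_on {T1..T2} (\<lambda>t. r t * cos (\<theta> t))"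
      by (rule DERIV_continuous_on[OF w'] DERIV_continuous_on[OF z'], assumption)+
    fix t assume t: "t \<in> {T1<..<T2}"
    hence t': "t \<in> {T1..T2}" by auto
    show "((\<lambda>t. r t * sin (\<theta> t)) has_real_derivative r t * cos (\<theta> t) / p t) (at t)"
      using w'[OF t'] t by (simp add: at_within_Icc_at)
    show "((\<lambda>t. r t * cos (\<theta> t)) has_real_derivative
         q t * (r t * sin (\<theta> t)) - (a * m t * pos_part (\<lambda>t. r t * sin (\<theta> t)) t
           - b * n t * neg_part (\<lambda>t. r t * sin (\<theta> t)) t)) (at t)"
      using z'[OF t'] t by (simp add: at_within_Icc_at)
  qed
  have "u T1 = 0" "u T2 = 0" using u(1) by (auto simp: solves_P_def)
  have eq: "u t = r t * sin (\<theta> t)" if "t \<in> {T1..T2}" for t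
    by (rule sl_system_unique[OF M N sys sys' _ _ that]) (use \<open>u T1 = 0\<close> r(2) \<theta>(2) in auto)
  have "sin (\<theta> T2) = 0" using eq[of T2] r(1)[of T2] \<open>u T2 = 0\<close> T by simp
  then obtain i :: int where i: "\<theta> T2 = of_int i * pi" by (auto simp: sin_zero_iff_int2)
  have "\<theta> T2 > 0" using prufer_above_multiple_of_pi[OF \<theta>(1), of T1 T2 0] T \<theta>(2) by auto
  hence "i > 0" using i by (simp add: zero_less_mult_iff)
  then obtain j where j: "i = int j" "0 < j" using zero_less_imp_eq_int by blast
  have "exactly_zeros T1 T2 (j - 1) (\<lambda>t. sin (\<theta> t))"
    by (rule prufer_zeros[OF \<theta>]) (use i j in simp)
  moreover have "{t \<in> {T1<..<T2}. sin (\<theta> t) = 0} = {t \<in> {T1<..<T2}. u t = 0}"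
  proof -
    have "(sin (\<theta> t) = 0) = (u t = 0)" if "t \<in> {T1<..<T2}" for t
      using eq[of t] r(1)[of t] that by simp
    thus ?thesis by blast
  qed
  ultimately have "j - 1 = k - 1" using u(2) by (simp add: exactly_zeros_def)
  with \<open>k \<ge> 1\<close> j i show ?thesis by simp
qed

end

section \<open>Alternating points of positivity\<close>

text \<open>
  The recursion exchanges the weights after the first point, just as a half-turn of the angle
  does; both directions of the nonemptiness criterion are inductions along this recursion.
\<close>

fun alternates :: "(real \<Rightarrow> real) \<Rightarrow> (real \<Rightarrow> real) \<Rightarrow> real \<Rightarrow> real \<Rightarrow> nat \<Rightarrow> bool" where
  "alternates m n s T 0 \<longleftrightarrow> True"
| "alternates m n s T (Suc k) \<longleftrightarrow> (\<exists>t. s < t \<and> t < T \<and> m t > 0 \<and> alternates n m t T k)"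

lemma alternates_mono: "alternates m n s T k \<Longrightarrow> s' \<le> s \<Longrightarrow> alternates m n s' T k"
  by (cases k) force+

lemma alternates_drop_last: "alternates m n s T (Suc k) \<Longrightarrow> alternates m n s T k"
proof (induction k arbitrary: m n s)
  case (Suc k)
  from Suc.prems obtain t where "s < t" "t < T" "m t > 0" "alternates n m t T (Suc k)"
    by (subst (asm) alternates.simps) blast
  with Suc.IH show ?case by (subst alternates.simps) blast
qed simp

lemma alternates_drop_first: "alternates m n s T (Suc k) \<Longrightarrow> alternates n m s T k"
  using alternates_mono[of n m _ T k s] by force

lemma alternates_scale:
  assumes "a > 0" "b > 0"
  shows "alternates (\<lambda>t. a * m t) (\<lambda>t. b * n t) s T k \<longleftrightarrow> alternates m n s T k"
  using assms
proof (induction k arbitrary: m n a b s)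
  case (Suc k)
  thus ?case by (simp add: zero_less_mult_iff)
qed simp

lemma positive_on_left_interval:
  fixes f :: "real \<Rightarrow> real"
  assumes "continuous_on {a..b} f" "a < t" "t \<le> b" "f t > 0"
  obtains c where "a < c" "c < t" "\<And>x. c \<le> x \<Longrightarrow> x \<le> t \<Longrightarrow> f x \<ge> f t / 2"
proof -
  from assms(1)[unfolded continuous_on_iff, rule_format, of t "f t / 2"] assms(2-4)
  obtain d where d: "d > 0" "\<And>x. x \<in> {a..b} \<Longrightarrow> \<bar>x - t\<bar> < d \<Longrightarrow> \<bar>f x - f t\<bar> < f t / 2"
    by (auto simp: dist_real_def)
  define c where "c = t - min d (t - a) / 2"
  have c: "a < c" "c < t" "t - c < d"
    using d(1) assms(2) by (auto simp: c_def min_def field_simps)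
  show ?thesis
  proof (rule that[OF c(1,2)])
    fix x assume "c \<le> x" "x \<le> t"
    hence "\<bar>f x - f t\<bar> < f t / 2" using c assms by (intro d(2)) auto
    thus "f x \<ge> f t / 2" by linarith
  qed
qed

text \<open>
  Compare the first points of the two chains: the chain with the later first point can be prolonged
  at its front by the first point of the other one. If the first points coincide, one of them is
  moved slightly to the left, which continuity permits.
\<close>

lemma alternates_extend:
  assumes n: "continuous_on {s..T} n"
    and "alternates m n s T (Suc k)" "alternates n m s T (Suc k)"
  shows "alternates m n s T (Suc (Suc k)) \<or> alternates n m s T (Suc (Suc k))"
proof -
  obtain t where t: "s < t" "t < T" "m t > 0" "alternates n m t T k"
    using assms(2) by auto
  obtain t' where t': "s < t'" "t' < T" "n t' > 0" "alternates m n t' T k"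
    using assms(3) by auto
  have after: "alternates n m s T (Suc (Suc k))" if "s < x" "x < t" "n x > 0" for x
    using that t by (simp only: alternates.simps) (meson less_trans)
  consider "t' < t" | "t < t'" | "t = t'" by linarith
  thus ?thesis
  proof cases
    case 1
    with after[of t'] t' show ?thesis by blast
  next
    case 2
    with t t' have "alternates m n s T (Suc (Suc k))" by (simp only: alternates.simps) blast
    thus ?thesis ..
  next
    case 3
    obtain c where "s < c" "c < t'" "n c \<ge> n t' / 2"
      using positive_on_left_interval[OF n t'(1) less_imp_le[OF t'(2)] t'(3)]
      by (metis less_imp_le order_refl)
    with after[of c] t'(3) 3 show ?thesis by simp
  qed
qed

text \<open>
  The order pattern behind the dichotomy: an object of length \<open>k + 1\<close> of one kind contains objects of
  length \<open>k\<close> of both kinds, and having both kinds in length \<open>k\<close> yields at least one kind in length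
  \<open>k + 1\<close>. The number \<open>k0\<close> is the last length at which both kinds occur.
\<close>

lemma paired_chain_pattern:
  fixes P Q :: "nat \<Rightarrow> bool"
  assumes "P 1" "Q 1"
    and down: "\<And>k. k \<ge> 1 \<Longrightarrow> P (Suc k) \<or> Q (Suc k) \<Longrightarrow> P k \<and> Q k"
    and up: "\<And>k. k \<ge> 1 \<Longrightarrow> P k \<Longrightarrow> Q k \<Longrightarrow> P (Suc k) \<or> Q (Suc k)"
  shows "(\<forall>k\<ge>1. P k \<and> Q k) \<or>
    (\<exists>k0\<ge>1. (\<forall>k. 1 \<le> k \<and> k \<le> k0 \<longrightarrow> P k \<and> Q k) \<and>
       ((P (k0 + 1) \<and> \<not> Q (k0 + 1)) \<or> (Q (k0 + 1) \<and> \<not> P (k0 + 1))) \<and>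
       (\<forall>k\<ge>k0 + 2. \<not> P k \<and> \<not> Q k))"
proof (cases "\<forall>k\<ge>1. P k \<and> Q k")
  case False
  define bad where "bad k \<longleftrightarrow> k \<ge> 1 \<and> \<not> (P k \<and> Q k)" for k
  from False have "\<exists>k. bad k" by (auto simp: bad_def)
  then obtain l where l: "bad l" "\<And>k. k < l \<Longrightarrow> \<not> bad k"
    using exists_least_iff[of bad] by blast
  have "l \<noteq> 1" using l(1) assms(1,2) by (auto simp: bad_def)
  with l(1) obtain k0 where k0: "l = Suc k0" "k0 \<ge> 1" by (cases l) (auto simp: bad_def)
  have good: "P k \<and> Q k" if "1 \<le> k" "k \<le> k0" for k
    using l(2)[of k] that k0 by (auto simp: bad_def)
  have l_bad: "\<not> (P (Suc k0) \<and> Q (Suc k0))" using l(1) k0 by (auto simp: bad_def)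
  have "\<not> P k \<and> \<not> Q k" if "k0 + 2 \<le> k" for k
    using that
  proof (induction k rule: dec_induct)
    case base
    show ?case using down[of "Suc k0"] l_bad by auto
  next
    case (step k)
    thus ?case using down[of k] by auto
  qed
  with good l_bad up[of k0] k0(2) show ?thesis by (intro disjI2 exI[of _ k0]) auto
qed simp

section \<open>Half-turns of the angle\<close>

context sturm_liouville
begin

text \<open>
  As long as \<open>0 \<le> \<theta> \<le> \<pi>/2\<close> and \<open>M \<le> 0 \<le> q\<close>, the velocity is at most \<open>cos\<^sup>2 \<theta> / p\<close>, whence
  \<open>(cos \<theta>)' \<ge> - C cos \<theta>\<close>: the cosine stays positive and \<open>\<pi>/2\<close> is never reached. In terms of \<open>u\<close>,
  a positive \<open>u\<close> with \<open>(p u')' \<ge> 0\<close> keeps increasing.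
\<close>

lemma quarter_turn_needs_positive_weight:
  assumes \<theta>: "prufer M N \<theta>" and s: "T1 \<le> s" "s \<le> z" "z \<le> T2" "\<theta> s = 0"
    and M: "\<And>t. s < t \<Longrightarrow> t < z \<Longrightarrow> M t \<le> 0"
  shows "\<theta> z < pi / 2"
proof (rule ccontr)
  assume "\<not> \<theta> z < pi / 2"
  moreover have cont: "continuous_on {s..z} \<theta>"
    by (rule continuous_on_subset[OF prufer_continuous[OF \<theta>]]) (use s in auto)
  ultimately obtain \<tau> where \<tau>: "s < \<tau>" "\<tau> \<le> z" "\<theta> \<tau> = pi / 2"
      "\<And>t. s \<le> t \<Longrightarrow> t < \<tau> \<Longrightarrow> \<theta> t < pi / 2"
    using first_hit[of s z \<theta> "pi / 2"] s by (auto simp: not_less)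
  from continuous_on_Icc_bounded[OF cont_inverse_p] obtain C where
    C: "C > 0" "\<And>t. t \<in> {T1..T2} \<Longrightarrow> \<bar>1 / p t\<bar> \<le> C" by blast
  have "- cos (\<theta> \<tau>) \<le> - cos (\<theta> s) * exp (- C * (\<tau> - s))"
  proof (rule gronwall)
    show "continuous_on {s..\<tau>} (\<lambda>t. - cos (\<theta> t))"
      by (intro continuous_intros continuous_on_subset[OF cont]) (use \<tau> in auto)
    fix t assume t: "s < t" "t < \<tau>"
    hence t': "T1 < t" "t < T2" "t \<in> {T1..T2}" using s \<tau> by auto
    let ?F = "prufer_field M N t (\<theta> t)"
    show "((\<lambda>t. - cos (\<theta> t)) has_real_derivative sin (\<theta> t) * ?F) (at t)"
      by (auto intro!: derivative_eq_intros prufer_interior[OF \<theta>] t')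
    have "0 < \<theta> t" using prufer_above_multiple_of_pi[OF \<theta>, of s t 0] s t t' by auto
    moreover have "\<theta> t < pi / 2" using \<tau>(4)[of t] t by auto
    ultimately have sc: "0 \<le> sin (\<theta> t)" "0 \<le> cos (\<theta> t)" and
      sin: "pos_sin (\<theta> t) = sin (\<theta> t)" "neg_sin (\<theta> t) = 0"
      by (auto intro!: sin_ge_zero cos_ge_zero pos_neg_sin_between)
    have "?F \<le> (cos (\<theta> t))\<^sup>2 / p t"
    proof -
      have "M t * (sin (\<theta> t))\<^sup>2 \<le> 0" "0 \<le> q t * (sin (\<theta> t))\<^sup>2"
        using M[of t] t \<tau>(2) q_nonneg[OF t'(3)] by (auto intro: mult_nonpos_nonneg)
      thus ?thesis unfolding prufer_field_def sin by simp
    qed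
    also have "\<dots> \<le> cos (\<theta> t) * C"
    proof -
      have "(cos (\<theta> t))\<^sup>2 * (1 / p t) \<le> cos (\<theta> t) * C"
        using C(2)[OF t'(3)] p_pos[OF t'(3)] sc
        by (intro mult_mono) (auto simp: power2_eq_square intro!: mult_left_le)
      thus ?thesis by simp
    qed
    finally have "sin (\<theta> t) * ?F \<le> sin (\<theta> t) * (cos (\<theta> t) * C)"
      using sc by (intro mult_left_mono)
    also have "\<dots> \<le> 1 * (cos (\<theta> t) * C)"
      using sc C(1) by (intro mult_right_mono) auto
    finally show "sin (\<theta> t) * ?F \<le> - C * - cos (\<theta> t)" by (simp add: mult.commute)
  qed (use \<tau> in simp)
  thus False using \<tau>(3) s(4) by simp
qed

text \<open>
  Each half-turn of the angle is a nodal interval, on which the active weight has to be positive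
  somewhere by the preceding lemma.
\<close>

lemma alternates_of_angle:
  assumes "prufer M N \<theta>" "T1 \<le> s" "s \<le> T2" "\<theta> s \<le> 0" "\<theta> T2 \<ge> of_nat k * pi"
  shows "alternates M N s T2 k"
  using assms
proof (induction k arbitrary: M N \<theta> s)
  case (Suc k)
  note \<theta> = Suc.prems(1)
  have "of_nat (Suc k) * pi = of_nat k * pi + pi" "0 \<le> of_nat k * pi"
    by (simp_all add: algebra_simps)
  with Suc.prems(5) have T2: "\<theta> T2 \<ge> pi" by linarith
  have cont: "continuous_on {s..T2} \<theta>"
    by (rule continuous_on_subset[OF prufer_continuous[OF \<theta>]]) (use Suc.prems in auto)
  obtain z0 where z0: "s \<le> z0" "z0 \<le> T2" "\<theta> z0 = 0"
    using IVT'[of \<theta> s 0 T2] Suc.prems(3,4) order_trans[OF pi_ge_zero T2] cont by auto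
  have "continuous_on {z0..T2} \<theta>"
    by (rule continuous_on_subset[OF cont]) (use z0 in auto)
  then obtain z1 where z1: "z0 < z1" "z1 \<le> T2" "\<theta> z1 = pi"
      "\<And>t. z0 \<le> t \<Longrightarrow> t < z1 \<Longrightarrow> \<theta> t < pi"
    using first_hit[of z0 T2 \<theta> pi] z0 T2 by auto
  have "\<exists>t. z0 < t \<and> t < z1 \<and> M t > 0"
  proof (rule ccontr)
    assume "\<not> (\<exists>t. z0 < t \<and> t < z1 \<and> M t > 0)"
    hence "M t \<le> 0" if "z0 < t" "t < z1" for t using that not_less by blast
    hence "\<theta> z1 < pi / 2"
      using z0 z1(1,2) Suc.prems(2) by (intro quarter_turn_needs_positive_weight[OF \<theta>, of z0]) auto
    with z1(3) show False by simp
  qed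
  then obtain t where t: "z0 < t" "t < z1" "M t > 0" by blast
  have "alternates N M t T2 k"
    by (rule Suc.IH[OF prufer_shift[OF \<theta>]])
       (use Suc.prems z0 z1(1-3) t less_imp_le[OF z1(4)[of t]] in \<open>auto simp: algebra_simps\<close>)
  moreover have "s < t" "t < T2" using t z0(1) z1(2) by simp_all
  ultimately show ?case using t(3) by auto
qed simp

text \<open>
  On a nodal interval \<open>\<theta>' \<ge> \<alpha> cos\<^sup>2 \<theta> + (\<alpha> / \<kappa>\<^sup>2) sin\<^sup>2 \<theta>\<close>, so that \<open>arctan (\<kappa> cot \<theta>)\<close> decreases at
  rate at least \<open>\<alpha> / \<kappa>\<close>. As its range has length \<open>\<pi>\<close>, a half-turn is completed within time
  \<open>\<pi> \<kappa> / \<alpha>\<close>. A large weight allows a small \<open>\<kappa>\<close>.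
\<close>

lemma half_turn:
  assumes \<theta>: "prufer M N \<theta>" and c: "T1 \<le> c" "c < d" "d \<le> T2" "\<theta> c > 0"
    and \<alpha>: "\<alpha> > 0" "\<And>t. c \<le> t \<Longrightarrow> t \<le> d \<Longrightarrow> \<alpha> \<le> 1 / p t"
    and \<kappa>: "\<kappa> > 0" "pi * \<kappa> \<le> \<alpha> * (d - c)"
    and M: "\<And>t. c \<le> t \<Longrightarrow> t \<le> d \<Longrightarrow> \<alpha> / \<kappa>\<^sup>2 \<le> M t - q t"
  shows "\<theta> d \<ge> pi"
proof (rule ccontr)
  assume "\<not> \<theta> d \<ge> pi"
  hence range: "0 < \<theta> t \<and> \<theta> t < pi" if "c \<le> t" "t \<le> d" for t
    using prufer_above_multiple_of_pi[OF \<theta>, of c t 0] prufer_above_multiple_of_pi[OF \<theta>, of t d 1]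
      c that by (cases "t = c"; cases "t = d") force+
  hence sin_pos: "sin (\<theta> t) > 0" if "c \<le> t" "t \<le> d" for t
    using that by (auto intro: sin_gt_zero)
  define g where "g t = arctan (\<kappa> * cot (\<theta> t)) + \<alpha> / \<kappa> * t" for t
  have "g d \<le> g c"
  proof (rule DERIV_nonpos_imp_decreasing_open[where f = g])
    have "continuous_on {c..d} \<theta>"
      by (rule continuous_on_subset[OF prufer_continuous[OF \<theta>]]) (use c in auto)
    moreover have "\<forall>t\<in>{c..d}. sin (\<theta> t) \<noteq> 0"
      using sin_pos by (auto simp: less_le)
    ultimately show "continuous_on {c..d} g"
      unfolding g_def cot_def by (intro continuous_intros)
    fix t assume t: "c < t" "t < d"
    let ?F = "prufer_field M N t (\<theta> t)" and ?s = "sin (\<theta> t)" and ?k = "cos (\<theta> t)"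
    have s: "?s > 0" using sin_pos[of t] t by simp
    let ?D = "?s\<^sup>2 + \<kappa>\<^sup>2 * ?k\<^sup>2"
    have D: "?D > 0" using s by (intro add_pos_nonneg) auto
    have "(\<theta> has_real_derivative ?F) (at t)" using t c by (intro prufer_interior[OF \<theta>]) auto
    moreover have "(cot has_real_derivative - inverse (?s\<^sup>2)) (at (\<theta> t))"
      using s by (intro DERIV_cot) simp
    ultimately have cot': "((\<lambda>t. cot (\<theta> t)) has_real_derivative - inverse (?s\<^sup>2) * ?F) (at t)"
      by (rule DERIV_chain2[rotated])
    have "(g has_real_derivative
        inverse (1 + (\<kappa> * cot (\<theta> t))\<^sup>2) * (\<kappa> * (- inverse (?s\<^sup>2) * ?F)) + \<alpha> / \<kappa>) (at t)"
      unfolding g_def using \<kappa>(1) by (auto intro!: derivative_eq_intros cot')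
    moreover have "inverse (1 + (\<kappa> * cot (\<theta> t))\<^sup>2) * (\<kappa> * (- inverse (?s\<^sup>2) * ?F)) = - (\<kappa> * ?F / ?D)"
    proof -
      have "1 + (\<kappa> * cot (\<theta> t))\<^sup>2 = ?D / ?s\<^sup>2"
        using s by (simp add: cot_def field_simps power2_eq_square)
      hence "inverse (1 + (\<kappa> * cot (\<theta> t))\<^sup>2) = ?s\<^sup>2 / ?D" by simp
      thus ?thesis using s by simp
    qed
    moreover have "\<alpha> / \<kappa> \<le> \<kappa> * ?F / ?D"
    proof -
      have sin: "pos_sin (\<theta> t) = ?s" "neg_sin (\<theta> t) = 0"
        using range[of t] t by (auto intro!: pos_neg_sin_between)
      have "\<alpha> / \<kappa> * ?D = \<kappa> * (\<alpha> * ?k\<^sup>2 + \<alpha> / \<kappa>\<^sup>2 * ?s\<^sup>2)"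
        using \<kappa>(1) by (simp add: field_simps power2_eq_square)
      also have "\<dots> \<le> \<kappa> * (1 / p t * ?k\<^sup>2 + (M t - q t) * ?s\<^sup>2)"
        using \<alpha>(2)[of t] M[of t] t \<kappa>(1) by (intro mult_left_mono add_mono mult_right_mono) auto
      also have "\<dots> = \<kappa> * ?F"
        unfolding prufer_field_def sin by (simp add: algebra_simps)
      finally show ?thesis using D by (simp add: pos_le_divide_eq)
    qed
    ultimately show "\<exists>y. (g has_real_derivative y) (at t) \<and> y \<le> 0"
      by (intro exI conjI) (assumption, simp)
  qed (use c in simp)
  moreover have "pi \<le> \<alpha> / \<kappa> * (d - c)"
    using \<kappa> by (simp add: field_simps)
  moreover have "arctan (\<kappa> * cot (\<theta> c)) < pi / 2" "- (pi / 2) < arctan (\<kappa> * cot (\<theta> d))"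
    using arctan_ubound arctan_lbound[of "\<kappa> * cot (\<theta> d)"] by simp_all
  moreover have "g d - g c = arctan (\<kappa> * cot (\<theta> d)) - arctan (\<kappa> * cot (\<theta> c)) + \<alpha> / \<kappa> * (d - c)"
    by (simp add: g_def right_diff_distrib)
  ultimately show False by linarith
qed

text \<open>
  Multiplying the weights by a large \<open>\<nu>\<close> forces one half-turn in a short interval to the left of each
  of the alternating points, where the active weight is bounded below by a positive constant.
\<close>

lemma angle_large:
  assumes "continuous_on {T1..T2} m" "continuous_on {T1..T2} n"
    and "T1 \<le> s" "s \<le> T2" "alternates m n s T2 k"
  shows "\<exists>\<Lambda>. \<forall>\<nu>\<ge>\<Lambda>. \<forall>\<theta>. prufer (\<lambda>t. \<nu> * m t) (\<lambda>t. \<nu> * n t) \<theta> \<longrightarrow> \<theta> s \<ge> 0 \<longrightarrow> \<theta> T2 \<ge> of_nat k * pi"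
  using assms
proof (induction k arbitrary: m n s)
  case 0
  have "\<theta> T2 \<ge> 0" if "prufer (\<lambda>t. \<nu> * m t) (\<lambda>t. \<nu> * n t) \<theta>" "\<theta> s \<ge> 0" for \<nu> \<theta>
    using prufer_above_multiple_of_pi[OF that(1), of s T2 0] that(2) 0 by (cases "s = T2") auto
  thus ?case by simp
next
  case (Suc k)
  from Suc.prems(5) obtain t where t: "s < t" "t < T2" "m t > 0" "alternates n m t T2 k" by auto
  obtain \<Lambda> where \<Lambda>: "\<And>\<nu> \<theta>. \<nu> \<ge> \<Lambda> \<Longrightarrow> prufer (\<lambda>t. \<nu> * n t) (\<lambda>t. \<nu> * m t) \<theta> \<Longrightarrow> \<theta> t \<ge> 0 \<Longrightarrow>
      \<theta> T2 \<ge> of_nat k * pi"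
    using Suc.IH[OF Suc.prems(2,1) _ _ t(4)] t Suc.prems(3) by auto
  have "continuous_on {s..T2} m"
    by (rule continuous_on_subset[OF Suc.prems(1)]) (use Suc.prems in auto)
  from positive_on_left_interval[OF this t(1) less_imp_le[OF t(2)] t(3)]
  obtain c where c: "s < c" "c < t" "\<And>x. c \<le> x \<Longrightarrow> x \<le> t \<Longrightarrow> m x \<ge> m t / 2" by blast
  from continuous_on_Icc_bounded[OF cont_p] obtain P where
    P: "P > 0" "\<And>x. x \<in> {T1..T2} \<Longrightarrow> \<bar>p x\<bar> \<le> P" by blast
  from continuous_on_Icc_bounded[OF cont_q] obtain Q where
    Q: "Q > 0" "\<And>x. x \<in> {T1..T2} \<Longrightarrow> \<bar>q x\<bar> \<le> Q" by blast
  define \<alpha> where "\<alpha> = 1 / P"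
  \<comment> \<open>\<open>\<kappa>\<close> makes the time \<open>\<pi> \<kappa> / \<alpha>\<close> of a half-turn equal to the length of \<open>[c, t]\<close>\<close>
  define \<kappa> where "\<kappa> = \<alpha> * (t - c) / pi"
  have \<alpha>: "\<alpha> > 0" and \<kappa>: "\<kappa> > 0" using P(1) c(2) by (auto simp: \<alpha>_def \<kappa>_def)
  \<comment> \<open>for \<open>\<nu> \<ge> \<mu>\<close> the weight \<open>\<nu> m - q\<close> is at least \<open>\<alpha> / \<kappa>\<^sup>2\<close> on \<open>[c, t]\<close>, as \<open>m \<ge> m t / 2\<close> and \<open>q \<le> Q\<close> there\<close>
  define \<mu> where "\<mu> = (Q + \<alpha> / \<kappa>\<^sup>2) / (m t / 2)"
  have "\<theta> T2 \<ge> of_nat (Suc k) * pi"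
    if \<nu>: "\<nu> \<ge> max \<Lambda> \<mu>" and \<theta>: "prufer (\<lambda>t. \<nu> * m t) (\<lambda>t. \<nu> * n t) \<theta>" "\<theta> s \<ge> 0" for \<nu> \<theta>
  proof -
    have "\<mu> > 0" using Q(1) \<alpha> \<kappa> t(3) by (simp add: \<mu>_def add_pos_pos)
    have "\<theta> t \<ge> pi"
    proof (rule half_turn[OF \<theta>(1) _ c(2) _ _ \<alpha> _ \<kappa>])
      show "T1 \<le> c" "t \<le> T2" using c t Suc.prems by auto
      show "0 < \<theta> c"
        using prufer_above_multiple_of_pi[OF \<theta>(1), of s c 0] c t Suc.prems \<theta>(2) by auto
      show "pi * \<kappa> \<le> \<alpha> * (t - c)" by (simp add: \<kappa>_def)
      fix x assume x: "c \<le> x" "x \<le> t"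
      hence x': "x \<in> {T1..T2}" using c t Suc.prems by auto
      show "\<alpha> \<le> 1 / p x"
        using P(2)[OF x'] p_pos[OF x'] by (simp add: \<alpha>_def frac_le)
      have "Q + \<alpha> / \<kappa>\<^sup>2 = \<mu> * (m t / 2)" using t(3) by (simp add: \<mu>_def)
      also have "\<dots> \<le> \<nu> * m x"
        using \<nu> \<open>\<mu> > 0\<close> c(3)[OF x] t(3) by (intro mult_mono) auto
      finally show "\<alpha> / \<kappa>\<^sup>2 \<le> \<nu> * m x - q x" using Q(2)[OF x'] by simp
    qed
    hence "\<theta> T2 - pi \<ge> of_nat k * pi"
      using \<nu> by (intro \<Lambda>[OF _ prufer_shift[OF \<theta>(1)]]) auto
    thus ?thesis by (simp add: algebra_simps)
  qed
  thus ?case by blast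
qed

section \<open>Nonemptiness of the Fucik sets\<close>

text \<open>
  The sets are met already on the diagonal \<open>a = b = \<nu>\<close>: the final angle depends continuously on \<open>\<nu>\<close>,
  is below \<open>\<pi>/2\<close> for \<open>\<nu> = 0\<close> and at least \<open>k \<pi>\<close> for large \<open>\<nu>\<close>.
\<close>

lemma diagonal_angle:
  assumes m: "continuous_on {T1..T2} m" and n: "continuous_on {T1..T2} n"
    and alt: "alternates m n T1 T2 k" and "k \<ge> 1"
  obtains \<nu> \<theta> where "\<nu> > 0" "prufer (\<lambda>t. \<nu> * m t) (\<lambda>t. \<nu> * n t) \<theta>" "\<theta> T1 = 0" "\<theta> T2 = of_nat k * pi"
proof -
  have M: "continuous_on {T1..T2} (\<lambda>t. \<nu> * m t)" and N: "continuous_on {T1..T2} (\<lambda>t. \<nu> * n t)" for \<nu>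
    by (intro continuous_intros m n)+
  have "\<exists>\<theta>. \<theta> T1 = 0 \<and> prufer (\<lambda>t. \<nu> * m t) (\<lambda>t. \<nu> * n t) \<theta>" for \<nu>
    using prufer_exists[OF M N] by blast
  then obtain \<Theta> where \<Theta>: "\<And>\<nu>. \<Theta> \<nu> T1 = 0" "\<And>\<nu>. prufer (\<lambda>t. \<nu> * m t) (\<lambda>t. \<nu> * n t) (\<Theta> \<nu>)"
    by metis
  have "continuous_on {T1..T2} (\<lambda>t. \<bar>m t\<bar> + \<bar>n t\<bar>)" by (intro continuous_intros m n)
  from continuous_on_Icc_bounded[OF this] obtain B where
    B: "B > 0" "\<And>t. t \<in> {T1..T2} \<Longrightarrow> \<bar>\<bar>m t\<bar> + \<bar>n t\<bar>\<bar> \<le> B" by blast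
  have diff: "\<bar>prufer_field (\<lambda>t. \<nu> * m t) (\<lambda>t. \<nu> * n t) t x
      - prufer_field (\<lambda>t. \<mu> * m t) (\<lambda>t. \<mu> * n t) t x\<bar> \<le> \<bar>\<nu> - \<mu>\<bar> * B"
    if t: "t \<in> {T1..T2}" for \<nu> \<mu> t x
  proof -
    have sq: "\<bar>m t * (pos_sin x)\<^sup>2\<bar> \<le> \<bar>m t\<bar>" "\<bar>n t * (neg_sin x)\<^sup>2\<bar> \<le> \<bar>n t\<bar>"
      using pos_neg_sin_bounds[of x] by (auto simp: abs_mult intro!: mult_left_le power_le_one)
    have "prufer_field (\<lambda>t. \<nu> * m t) (\<lambda>t. \<nu> * n t) t x - prufer_field (\<lambda>t. \<mu> * m t) (\<lambda>t. \<mu> * n t) t x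
        = (\<nu> - \<mu>) * (m t * (pos_sin x)\<^sup>2 + n t * (neg_sin x)\<^sup>2)"
      by (simp add: prufer_field_def algebra_simps)
    moreover have "\<bar>m t * (pos_sin x)\<^sup>2 + n t * (neg_sin x)\<^sup>2\<bar> \<le> B"
      using sq B(2)[OF t] by linarith
    ultimately show ?thesis by (simp add: abs_mult mult_left_mono)
  qed
  have cont: "continuous_on UNIV (\<lambda>\<nu>. \<Theta> \<nu> T2)"
    unfolding continuous_on_iff
  proof (intro ballI allI impI)
    fix \<nu> e :: real assume "e > 0"
    obtain L where L: "\<And>t x y. t \<in> {T1..T2} \<Longrightarrow>
      \<bar>prufer_field (\<lambda>t. \<nu> * m t) (\<lambda>t. \<nu> * n t) t x - prufer_field (\<lambda>t. \<nu> * m t) (\<lambda>t. \<nu> * n t) t y\<bar>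
        \<le> L * \<bar>x - y\<bar>"
      by (rule prufer_field_lipschitz[OF M[of \<nu>] N[of \<nu>]]) (rule that)
    define C where "C = B * exp ((2 * L + 1) * (T2 - T1) / 2)"
    have C: "C > 0" using B(1) by (simp add: C_def)
    have le: "\<bar>\<Theta> \<nu> T2 - \<Theta> \<mu> T2\<bar> \<le> \<bar>\<nu> - \<mu>\<bar> * C" for \<mu>
    proof (rule abs_le_square_iff[THEN iffD2, THEN order_trans])
      have "(\<Theta> \<nu> T2 - \<Theta> \<mu> T2)\<^sup>2 \<le> (\<bar>\<nu> - \<mu>\<bar> * B)\<^sup>2 * exp ((2 * L + 1) * (T2 - T1))"
        by (rule prufer_gronwall[OF \<Theta>(2) \<Theta>(2) _ L diff]) (simp_all add: \<Theta>(1))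
      also have "\<dots> = (\<bar>\<nu> - \<mu>\<bar> * C)\<^sup>2"
        by (simp add: C_def power_mult_distrib flip: exp_double)
      finally show "(\<Theta> \<nu> T2 - \<Theta> \<mu> T2)\<^sup>2 \<le> (\<bar>\<nu> - \<mu>\<bar> * C)\<^sup>2" .
    qed (use C in \<open>simp add: abs_mult\<close>)
    show "\<exists>d>0. \<forall>\<mu>\<in>UNIV. dist \<mu> \<nu> < d \<longrightarrow> dist (\<Theta> \<mu> T2) (\<Theta> \<nu> T2) < e"
    proof (intro exI[of _ "e / C"] conjI ballI impI)
      show "e / C > 0" using \<open>e > 0\<close> C by simp
      fix \<mu> assume "dist \<mu> \<nu> < e / C"
      hence "\<bar>\<nu> - \<mu>\<bar> * C < e" using C by (simp add: dist_real_def abs_minus_commute field_simps)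
      with le[of \<mu>] show "dist (\<Theta> \<mu> T2) (\<Theta> \<nu> T2) < e" by (simp add: dist_real_def abs_minus_commute)
    qed
  qed
  obtain \<Lambda> where \<Lambda>: "\<And>\<nu> \<theta>. \<nu> \<ge> \<Lambda> \<Longrightarrow> prufer (\<lambda>t. \<nu> * m t) (\<lambda>t. \<nu> * n t) \<theta> \<Longrightarrow> \<theta> T1 \<ge> 0 \<Longrightarrow>
      \<theta> T2 \<ge> of_nat k * pi"
    using angle_large[OF m n _ _ alt] T by auto
  \<comment> \<open>for \<open>\<nu> = 0\<close> both weights vanish, so no quarter-turn is possible\<close>
  have zero: "\<Theta> 0 T2 < pi / 2"
    by (rule quarter_turn_needs_positive_weight[OF \<Theta>(2)[of 0], of T1]) (use T \<Theta>(1) in auto)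
  have "pi / 2 < of_nat k * pi"
  proof -
    have "1 * pi \<le> of_nat k * pi" using \<open>k \<ge> 1\<close> by (intro mult_right_mono) auto
    thus ?thesis using pi_gt_zero by linarith
  qed
  with zero have less: "\<Theta> 0 T2 < of_nat k * pi" by (rule less_trans)
  have "of_nat k * pi \<le> \<Theta> (max \<Lambda> 0) T2"
    by (rule \<Lambda>[OF _ \<Theta>(2)]) (simp_all add: \<Theta>(1))
  from IVT'[OF less_imp_le[OF less] this max.cobounded2 continuous_on_subset[OF cont subset_UNIV]]
  obtain \<nu> where \<nu>: "0 \<le> \<nu>" "\<Theta> \<nu> T2 = of_nat k * pi" by blast
  moreover have "\<nu> \<noteq> 0" using less \<nu>(2) by auto
  ultimately show ?thesis using that[of \<nu> "\<Theta> \<nu>"] \<Theta> by auto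
qed

lemma C_gt_pp_nonempty_iff:
  assumes m: "continuous_on {T1..T2} m" and n: "continuous_on {T1..T2} n" and k: "k \<ge> 1"
  shows "C_gt_pp T1 T2 p q m n k \<noteq> {} \<longleftrightarrow> alternates m n T1 T2 k"
proof
  assume "C_gt_pp T1 T2 p q m n k \<noteq> {}"
  then obtain a b where ab: "a > 0" "b > 0" "(a, b) \<in> C_gt T1 T2 p q m n k"
    by (auto simp: C_gt_pp_def)
  have "continuous_on {T1..T2} (\<lambda>t. a * m t)" "continuous_on {T1..T2} (\<lambda>t. b * n t)"
    by (intro continuous_intros m n)+
  then obtain \<theta> where \<theta>: "\<theta> T1 = 0" "prufer (\<lambda>t. a * m t) (\<lambda>t. b * n t) \<theta>"
    by (rule prufer_exists)
  have "\<theta> T2 = of_nat k * pi" by (rule angle_of_C_gt[OF m n \<theta>(2,1) ab(3) k])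
  hence "alternates (\<lambda>t. a * m t) (\<lambda>t. b * n t) T1 T2 k"
    using T \<theta> by (intro alternates_of_angle[OF \<theta>(2)]) auto
  thus "alternates m n T1 T2 k" using alternates_scale ab by blast
next
  assume "alternates m n T1 T2 k"
  from diagonal_angle[OF m n this k] obtain \<nu> \<theta> where
    "\<nu> > 0" "prufer (\<lambda>t. \<nu> * m t) (\<lambda>t. \<nu> * n t) \<theta>" "\<theta> T1 = 0" "\<theta> T2 = of_nat k * pi" by blast
  with C_gt_of_angle[OF m n] have "(\<nu>, \<nu>) \<in> C_gt_pp T1 T2 p q m n k"
    by (auto simp: C_gt_pp_def)
  thus "C_gt_pp T1 T2 p q m n k \<noteq> {}" by blast
qed

text \<open>
  Reflecting \<open>u\<close> exchanges \<open>(a, m)\<close> with \<open>(b, n)\<close> and the sign of the initial slope, which reduces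
  the sets \<open>C_lt\<close> to the sets \<open>C_gt\<close>.
\<close>

lemma solves_P_uminus:
  assumes u: "solves_P T1 T2 p q m n a b u"
  shows "solves_P T1 T2 p q n m b a (\<lambda>t. - u t)"
    and "deriv_Icc T1 T2 (\<lambda>t. - u t) T1 = - deriv_Icc T1 T2 u T1"
proof -
  let ?v = "\<lambda>t. p t * deriv_Icc T1 T2 u t"
  have C1: "C1_Icc T1 T2 u" "C1_Icc T1 T2 ?v" using u by (auto simp: solves_P_def)
  have u': "((\<lambda>t. - u t) has_real_derivative - deriv_Icc T1 T2 u t) (at t within {T1..T2})"
    if "t \<in> {T1..T2}" for t
    by (intro derivative_intros C1_Icc_D[OF T C1(1) that])
  have du: "deriv_Icc T1 T2 (\<lambda>t. - u t) t = - deriv_Icc T1 T2 u t" if "t \<in> {T1..T2}" for t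
    by (rule deriv_Icc_eqI[OF T that u'[OF that]])
  have v': "((\<lambda>t. p t * deriv_Icc T1 T2 (\<lambda>t. - u t) t) has_real_derivative - deriv_Icc T1 T2 ?v t)
      (at t within {T1..T2})" if t: "t \<in> {T1..T2}" for t
  proof (rule has_field_derivative_transform_within[OF _ zero_less_one t])
    show "((\<lambda>t. - ?v t) has_real_derivative - deriv_Icc T1 T2 ?v t) (at t within {T1..T2})"
      by (intro derivative_intros C1_Icc_D[OF T C1(2) t])
  qed (simp add: du)
  have cont: "continuous_on {T1..T2} (\<lambda>t. - deriv_Icc T1 T2 u t)"
    "continuous_on {T1..T2} (\<lambda>t. - deriv_Icc T1 T2 ?v t)"
    using C1 by (auto simp: C1_Icc_def intro: continuous_on_minus)
  show "deriv_Icc T1 T2 (\<lambda>t. - u t) T1 = - deriv_Icc T1 T2 u T1"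
    using du T by simp
  show "solves_P T1 T2 p q n m b a (\<lambda>t. - u t)"
    unfolding solves_P_def
  proof (intro conjI ballI)
    show "C1_Icc T1 T2 (\<lambda>t. - u t)" by (rule C1_Icc_I[OF T u' cont(1)])
    show "C1_Icc T1 T2 (\<lambda>t. p t * deriv_Icc T1 T2 (\<lambda>t. - u t) t)"
      by (rule C1_Icc_I[OF T v' cont(2)])
    fix t assume t: "t \<in> {T1<..<T2}"
    have "- deriv_Icc T1 T2 ?v t + q t * u t = a * m t * pos_part u t - b * n t * neg_part u t"
      using u t by (auto simp: solves_P_def SL_op_def)
    moreover have "deriv_Icc T1 T2 (\<lambda>t. p t * deriv_Icc T1 T2 (\<lambda>t. - u t) t) t = - deriv_Icc T1 T2 ?v t"
      using t by (intro deriv_Icc_eqI[OF T] v') auto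
    ultimately show "SL_op T1 T2 p q (\<lambda>t. - u t) t
        = b * n t * pos_part (\<lambda>t. - u t) t - a * m t * neg_part (\<lambda>t. - u t) t"
      by (simp add: SL_op_def pos_part_def neg_part_def algebra_simps)
  qed (use u in \<open>auto simp: solves_P_def\<close>)
qed

lemma C_lt_iff_C_gt_swapped:
  "(a, b) \<in> C_lt T1 T2 p q m n k \<longleftrightarrow> (b, a) \<in> C_gt T1 T2 p q n m k"
proof
  assume "(a, b) \<in> C_lt T1 T2 p q m n k"
  then obtain u where u: "solves_P T1 T2 p q m n a b u" "exactly_zeros T1 T2 (k - 1) u"
      "deriv_Icc T1 T2 u T1 < 0"
    by (auto simp: C_lt_def)
  moreover have "exactly_zeros T1 T2 (k - 1) (\<lambda>t. - u t)" using u(2) by (simp add: exactly_zeros_def)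
  ultimately show "(b, a) \<in> C_gt T1 T2 p q n m k"
    using solves_P_uminus[OF u(1)] by (auto simp: C_gt_def intro!: exI[of _ "\<lambda>t. - u t"])
next
  assume "(b, a) \<in> C_gt T1 T2 p q n m k"
  then obtain u where u: "solves_P T1 T2 p q n m b a u" "exactly_zeros T1 T2 (k - 1) u"
      "deriv_Icc T1 T2 u T1 > 0"
    by (auto simp: C_gt_def)
  moreover have "exactly_zeros T1 T2 (k - 1) (\<lambda>t. - u t)" using u(2) by (simp add: exactly_zeros_def)
  ultimately show "(a, b) \<in> C_lt T1 T2 p q m n k"
    using solves_P_uminus[OF u(1)] by (auto simp: C_lt_def intro!: exI[of _ "\<lambda>t. - u t"])
qed

lemma C_lt_pp_nonempty_iff:
  assumes m: "continuous_on {T1..T2} m" and n: "continuous_on {T1..T2} n" and k: "k \<ge> 1"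
  shows "C_lt_pp T1 T2 p q m n k \<noteq> {} \<longleftrightarrow> alternates n m T1 T2 k"
proof -
  have "C_lt_pp T1 T2 p q m n k \<noteq> {} \<longleftrightarrow> (\<exists>a b. a > 0 \<and> b > 0 \<and> (a, b) \<in> C_lt T1 T2 p q m n k)"
    by (auto simp: C_lt_pp_def)
  also have "\<dots> \<longleftrightarrow> (\<exists>a b. a > 0 \<and> b > 0 \<and> (a, b) \<in> C_gt T1 T2 p q n m k)"
    unfolding C_lt_iff_C_gt_swapped by blast
  also have "\<dots> \<longleftrightarrow> C_gt_pp T1 T2 p q n m k \<noteq> {}"
    by (auto simp: C_gt_pp_def)
  finally show ?thesis using C_gt_pp_nonempty_iff[OF n m k] by simp
qed

end

theorem corollary3p8:
  fixes T1 T2 :: real and p q m n :: "real \<Rightarrow> real"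
  assumes "T1 < T2"
    and "continuous_on {T1..T2} p" and "continuous_on {T1..T2} q"
    and "continuous_on {T1..T2} m" and "continuous_on {T1..T2} n"
    and "\<forall>t\<in>{T1..T2}. p t > 0" and "\<forall>t\<in>{T1..T2}. q t \<ge> 0"
    and "\<exists>t\<in>{T1..T2}. m t \<noteq> 0" and "\<exists>t\<in>{T1..T2}. n t \<noteq> 0"
    and "\<exists>t\<in>{T1<..<T2}. pos_part m t \<noteq> 0" and "\<exists>t\<in>{T1<..<T2}. pos_part n t \<noteq> 0"
  shows "(\<forall>k\<ge>1. C_gt_pp T1 T2 p q m n k \<noteq> {} \<and> C_lt_pp T1 T2 p q m n k \<noteq> {}) \<or>
    (\<exists>k0\<ge>1.
       (\<forall>k. 1 \<le> k \<and> k \<le> k0 \<longrightarrow> C_gt_pp T1 T2 p q m n k \<noteq> {} \<and> C_lt_pp T1 T2 p q m n k \<noteq> {}) \<and>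
       ((C_gt_pp T1 T2 p q m n (k0 + 1) \<noteq> {} \<and> C_lt_pp T1 T2 p q m n (k0 + 1) = {}) \<or>
        (C_lt_pp T1 T2 p q m n (k0 + 1) \<noteq> {} \<and> C_gt_pp T1 T2 p q m n (k0 + 1) = {})) \<and>
       (\<forall>k\<ge>k0 + 2. C_gt_pp T1 T2 p q m n k = {} \<and> C_lt_pp T1 T2 p q m n k = {}))"
proof -
  interpret sturm_liouville T1 T2 p q
    using assms by unfold_locales auto
  note gt = C_gt_pp_nonempty_iff[OF assms(4,5)] and lt = C_lt_pp_nonempty_iff[OF assms(4,5)]
  let ?P = "\<lambda>k. C_gt_pp T1 T2 p q m n k \<noteq> {}" and ?Q = "\<lambda>k. C_lt_pp T1 T2 p q m n k \<noteq> {}"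
  have "alternates m n T1 T2 1" "alternates n m T1 T2 1"
    using assms(10,11) by (auto simp: pos_part_def max_def split: if_splits)
  hence one: "?P 1" "?Q 1" by (simp_all only: gt lt le_refl)
  have down: "?P k \<and> ?Q k" if "k \<ge> 1" "?P (Suc k) \<or> ?Q (Suc k)" for k
  proof -
    have "alternates m n T1 T2 (Suc k) \<or> alternates n m T1 T2 (Suc k)"
      using that(2) gt[of "Suc k"] lt[of "Suc k"] by auto
    thus ?thesis
      using gt[OF that(1)] lt[OF that(1)] alternates_drop_first alternates_drop_last by blast
  qed
  have up: "?P (Suc k) \<or> ?Q (Suc k)" if "k \<ge> 1" "?P k" "?Q k" for k
  proof -
    obtain j where j: "k = Suc j" using \<open>k \<ge> 1\<close> by (cases k) auto
    have "alternates m n T1 T2 (Suc k) \<or> alternates n m T1 T2 (Suc k)"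
      using that gt[OF that(1)] lt[OF that(1)] unfolding j
      by (intro alternates_extend[OF assms(5)]) auto
    thus ?thesis using gt[of "Suc k"] lt[of "Suc k"] by auto
  qed
  from paired_chain_pattern[of ?P ?Q, OF one down up] show ?thesis by simp
qed

end
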